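(* Let $n\ge 1$ and let $f\in L^\infty(\mathbb R^n)\cap C^N(\mathbb R^n\setminus\{0\})$, where $N>n$ is an integer. Assume that there exist constants $C>0$, $\delta_1>0$, $\delta_2>0$ such that for all multi-indices $\alpha$ with $|\alpha|\le N$, $$|\partial^\alpha f(\xi)|\le C\,|\xi|^{-\delta_1-|\alpha|},\qquad |\xi|\ge 1,$$ $$|\partial^\alpha f(\xi)|\le C\,|\xi|^{\delta_2-|\alpha|}\bigl(1+|\ln|\xi||\bigr),\qquad 0<|\xi|\le 2.$$ Then there exists $g\in L^1(\mathbb R^n)$ such that $\widehat g(\xi)=f(\xi)$ for a.e. $\xi\in\mathbb R^n$.
   Context: The Fourier transform is $\widehat g(\xi)=\int_{\mathbb{R}^n}g(x)e^{-2\pi i x\cdot\xi}\,dx$. *)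

theory Defs
  imports "HOL-Analysis.Analysis"
begin

definition has_partial :: "'n::finite \<Rightarrow> (real ^ 'n \<Rightarrow> complex) \<Rightarrow> real ^ 'n \<Rightarrow> bool" where
  "has_partial i f x \<longleftrightarrow> (\<lambda>t::real. f (x + t *\<^sub>R axis i 1)) differentiable (at 0)"

text \<open>As for \<^const>\<open>vector_derivative\<close>, the value is meaningful only where \<open>has_partial\<close> holds.\<close>

definition partial :: "'n::finite \<Rightarrow> (real ^ 'n \<Rightarrow> complex) \<Rightarrow> real ^ 'n \<Rightarrow> complex" where
  "partial i f x = vector_derivative (\<lambda>t::real. f (x + t *\<^sub>R axis i 1)) (at 0)"

text \<open>\<open>Ck_on k S f\<close>, meant for open \<open>S\<close>: all iterated partial derivatives of \<open>f\<close> of order at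
  most \<open>k\<close>, taken in any order, exist and are continuous on \<open>S\<close>.\<close>

fun Ck_on :: "nat \<Rightarrow> (real ^ 'n::finite) set \<Rightarrow> (real ^ 'n \<Rightarrow> complex) \<Rightarrow> bool" where
  "Ck_on 0 S f \<longleftrightarrow> continuous_on S f"
| "Ck_on (Suc k) S f \<longleftrightarrow>
     continuous_on S f \<and> (\<forall>i. (\<forall>x\<in>S. has_partial i f x) \<and> Ck_on k S (partial i f))"

text \<open>The index type carries no order, so an enumeration of the coordinates is fixed once and for
  all to order the factors of \<open>\<partial>\<^sup>\<alpha>\<close>. For \<open>f\<close> of class \<open>C\<^sup>k\<close> on an open set and
  \<open>\<bar>\<alpha>\<bar> \<le> k\<close>, the derivative on that set does not depend on the enumeration, since mixed partial
  derivatives commute.\<close>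

definition coords :: "'n::finite list" where
  "coords = (SOME is. distinct is \<and> set is = UNIV)"

definition partials :: "('n::finite \<Rightarrow> nat) \<Rightarrow> (real ^ 'n \<Rightarrow> complex) \<Rightarrow> real ^ 'n \<Rightarrow> complex" where
  "partials \<alpha> f = foldr (\<lambda>i. partial i ^^ \<alpha> i) coords f"

definition order_of :: "('n::finite \<Rightarrow> nat) \<Rightarrow> nat" where
  "order_of \<alpha> = (\<Sum>i\<in>UNIV. \<alpha> i)"

definition L_infinity :: "(real ^ 'n::finite \<Rightarrow> complex) \<Rightarrow> bool" where
  "L_infinity f \<longleftrightarrow>
     f \<in> borel_measurable lebesgue \<and> (\<exists>M. AE x in lebesgue. norm (f x) \<le> M)"

definition fourier :: "(real ^ 'n::finite \<Rightarrow> complex) \<Rightarrow> real ^ 'n \<Rightarrow> complex" where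
  "fourier g \<xi> = (LINT x|lebesgue. g x * exp (- 2 * of_real pi * \<i> * of_real (x \<bullet> \<xi>)))"

end

theory Submission
  imports Defs "HOL-Probability.Characteristic_Functions"
begin

text \<open>
  The symbol \<open>f\<close> is cut into dyadic pieces, each piece is written as the Fourier transform of an
  \<open>L\<^sup>1\<close> function, and the \<open>L\<^sup>1\<close> norms are summed.

  Let \<open>\<phi> \<xi> = X \<xi> - X (2 *\<^sub>R \<xi>)\<close>, where \<open>X\<close> is a compactly supported cutoff of class \<open>C\<^sup>N\<close> equal to
  \<open>1\<close> on the unit ball. The sum of \<open>\<phi> (\<xi> /\<^sub>R s)\<close> over all dyadic scales \<open>s\<close>, large and small,
  telescopes to \<open>1\<close> for \<open>\<xi> \<noteq> 0\<close> (\<open>dyadic_resolution\<close>). The rescaled piece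
  \<open>h s x = f (s *\<^sub>R x) * \<phi> x\<close> is supported in a fixed annulus, and since the hypotheses on the
  derivatives of \<open>f\<close> are invariant under dilation up to the gain
  \<open>min (s powr \<delta>) (s powr (- \<delta>))\<close>, all pure derivatives of \<open>h s\<close> up to order \<open>N\<close> are bounded by a
  constant times this gain (\<open>localised_pieces\<close>).

  Integrating by parts \<open>N\<close> times in each coordinate direction shows that the inverse Fourier transform
  of \<open>h s\<close> is dominated by the gain times a fixed weight, integrable because \<open>N\<close> exceeds the dimension
  (\<open>inverse_fourier_decay\<close>). Fourier inversion then holds for \<open>h s\<close> (\<open>fourier_inversion\<close>,
  proved by Gaussian regularisation), and undoing the dilation changes neither the \<open>L\<^sup>1\<close> norm nor
  this conclusion. As \<open>\<delta> > 0\<close>, the gains over the dyadic scales form a convergent geometric series, so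
  the functions obtained sum in \<open>L\<^sup>1\<close> to a function whose transform is \<open>f\<close> away from the origin
  (\<open>fourier_suminf\<close>).

  The cutoff is a tensor product and all decay is measured by a tensor weight. Consequently only the
  derivatives \<open>(partial i ^^ k) f\<close> in a single direction occur.
\<close>

section \<open>Integration in Cartesian coordinates\<close>

lemma prod_Basis_vec:
  "(\<Prod>b\<in>(Basis :: (real ^ 'n::finite) set). F b) = (\<Prod>i\<in>UNIV. F (axis i 1))"
proof -
  have B: "(Basis :: (real ^ 'n) set) = range (\<lambda>i. axis i 1)"
    by (auto simp: Basis_vec_def)
  have inj: "inj (\<lambda>i::'n. axis i (1::real))"
    by (auto simp: inj_on_def axis_eq_axis)
  show ?thesis
    unfolding B by (simp add: prod.reindex[OF inj])
qed

text \<open>Lebesgue measure on \<open>real ^ 'n\<close> is the image of the product of one-dimensional Lebesgue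
  measures under the map assembling a vector from its coordinates, so this is Fubini for tensor
  products.\<close>
lemma
  fixes f :: "'n::finite \<Rightarrow> real \<Rightarrow> 'a::{real_normed_field,banach,second_countable_topology}"
  assumes f: "\<And>i. integrable lborel (f i)"
  shows integrable_coordinate_product:
      "integrable lborel (\<lambda>x::real ^ 'n. \<Prod>i\<in>UNIV. f i (x $ i))"
    and integral_coordinate_product:
      "(\<integral>x. (\<Prod>i\<in>UNIV. f i (x $ i)) \<partial>lborel) = (\<Prod>i\<in>UNIV. \<integral>t. f i t \<partial>lborel)"
proof -
  interpret product_sigma_finite "\<lambda>b::real ^ 'n. lborel :: real measure" ..
  let ?B = "Basis :: (real ^ 'n) set"
  let ?P = "Pi\<^sub>M ?B (\<lambda>_. lborel :: real measure)"
  let ?T = "\<lambda>y::real ^ 'n \<Rightarrow> real. \<Sum>b\<in>?B. y b *\<^sub>R b"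
  define g where "g b = f (axis_index b)" for b :: "real ^ 'n"
  have [measurable]: "f i \<in> borel_measurable borel" for i
    using borel_measurable_integrable[OF f[of i]] by simp
  have [measurable]: "?T \<in> ?P \<rightarrow>\<^sub>M borel"
    by measurable
  have meas: "(\<lambda>x::real ^ 'n. \<Prod>i\<in>UNIV. f i (x $ i)) \<in> borel_measurable borel"
    by measurable
  have eq: "(\<Prod>i\<in>UNIV. f i (?T y $ i)) = (\<Prod>b\<in>?B. g b (y b))" for y
  proof -
    have "?T y $ i = y (axis i 1)" for i
      unfolding cart_eq_inner_axis by (rule inner_sum_left_Basis) (simp add: axis_in_Basis_iff)
    then show ?thesis
      by (simp add: prod_Basis_vec g_def axis_index_axis)
  qed
  have "integrable ?P (\<lambda>y. \<Prod>b\<in>?B. g b (y b))"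
    by (rule product_integrable_prod) (auto simp: g_def f)
  then show "integrable lborel (\<lambda>x::real ^ 'n. \<Prod>i\<in>UNIV. f i (x $ i))"
    unfolding lborel_eq[where 'a="real ^ 'n"]
    by (subst integrable_distr_eq) (use meas in \<open>auto simp: eq simp del: sum_component\<close>)
  have "(\<integral>x. (\<Prod>i\<in>UNIV. f i (x $ i)) \<partial>lborel) = (\<integral>y. (\<Prod>b\<in>?B. g b (y b)) \<partial>?P)"
    unfolding lborel_eq[where 'a="real ^ 'n"]
    by (subst integral_distr) (use meas in \<open>auto simp: eq simp del: sum_component\<close>)
  also have "\<dots> = (\<Prod>b\<in>?B. \<integral>t. g b t \<partial>lborel)"
    by (rule product_integral_prod) (auto simp: g_def f)
  also have "\<dots> = (\<Prod>i\<in>UNIV. \<integral>t. f i t \<partial>lborel)"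
    by (simp add: prod_Basis_vec g_def axis_index_axis)
  finally show "(\<integral>x. (\<Prod>i\<in>UNIV. f i (x $ i)) \<partial>lborel) = (\<Prod>i\<in>UNIV. \<integral>t. f i t \<partial>lborel)" .
qed

lemma
  fixes f :: "'a::euclidean_space \<Rightarrow> 'b::{banach,second_countable_topology}"
  assumes c: "c \<noteq> 0" and f: "integrable lborel f"
  shows integrable_lborel_affine: "integrable lborel (\<lambda>x. f (t + c *\<^sub>R x))"
    and integral_lborel_affine:
      "(\<integral>x. f x \<partial>lborel) = \<bar>c\<bar> ^ DIM('a) *\<^sub>R (\<integral>x. f (t + c *\<^sub>R x) \<partial>lborel)"
proof -
  have [measurable]: "f \<in> borel_measurable borel"
    using borel_measurable_integrable[OF f] by simp
  have "integrable lborel (\<lambda>x. \<bar>c\<bar> ^ DIM('a) *\<^sub>R f (t + c *\<^sub>R x))"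
    using f
    by (subst (asm) lborel_affine[OF c, of t]) (simp add: integrable_density integrable_distr_eq)
  then show "integrable lborel (\<lambda>x. f (t + c *\<^sub>R x))"
    using c integrable_scaleR_right[of "inverse (\<bar>c\<bar> ^ DIM('a))"
        lborel "\<lambda>x. \<bar>c\<bar> ^ DIM('a) *\<^sub>R f (t + c *\<^sub>R x)"] by simp
  show "(\<integral>x. f x \<partial>lborel) = \<bar>c\<bar> ^ DIM('a) *\<^sub>R (\<integral>x. f (t + c *\<^sub>R x) \<partial>lborel)"
    by (subst lborel_affine[OF c, of t]) (simp add: integral_density integral_distr)
qed

lemma borel_measurable_cis [measurable]: "cis \<in> borel \<rightarrow>\<^sub>M borel"
  by (intro borel_measurable_continuous_onI continuous_intros)

text \<open>The Gaussian is a tensor product, so everything reduces to the characteristic function of the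
  standard normal distribution on the line.\<close>
lemma
  fixes w :: "real ^ 'n::finite"
  shows integrable_gaussian: "integrable lborel (\<lambda>x::real ^ 'n. exp (- (x \<bullet> x) / 2))"
    and gaussian_integral:
      "integral\<^sup>L lborel (\<lambda>x::real ^ 'n. exp (- (x \<bullet> x) / 2)) = sqrt (2 * pi) ^ CARD('n)"
    and gaussian_fourier:
      "(\<integral>x. of_real (exp (- (x \<bullet> x) / 2)) * cis (x \<bullet> w) \<partial>lborel)
         = of_real (sqrt (2 * pi) ^ CARD('n) * exp (- (w \<bullet> w) / 2))"
proof -
  have norm: "exp (- t\<^sup>2 / 2) = sqrt (2 * pi) * std_normal_density t" for t
    by (simp add: std_normal_density_def)
  have ir: "integrable lborel (\<lambda>t::real. exp (- t\<^sup>2 / 2))"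
    unfolding norm using integrable_std_normal_moment[of 0] by (simp add: power_0)
  have ic: "integrable lborel (\<lambda>t::real. of_real (exp (- t\<^sup>2 / 2)) * cis (t * v))" for v
    by (rule Bochner_Integration.integrable_bound[OF ir]) (auto simp: norm_mult)
  have f1: "(\<integral>t. of_real (exp (- t\<^sup>2 / 2)) * cis (t * v) \<partial>lborel)
      = of_real (sqrt (2 * pi)) * of_real (exp (- v\<^sup>2 / 2))" for v :: real
  proof -
    have "(\<integral>t. of_real (exp (- t\<^sup>2 / 2)) * cis (t * v) \<partial>lborel)
       = (\<integral>t. of_real (sqrt (2 * pi)) * (std_normal_density t *\<^sub>R iexp (v * t)) \<partial>lborel)"
      unfolding norm
      by (intro Bochner_Integration.integral_cong) (auto simp: scaleR_conv_of_real cis_conv_exp mult_ac)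
    also have "\<dots> = of_real (sqrt (2 * pi)) * char std_normal_distribution v"
      by (subst integral_mult_right_zero) (simp add: char_def integral_density)
    finally show ?thesis
      by (simp add: char_std_normal_distribution)
  qed
  have split_r: "exp (- (x \<bullet> x) / 2) = (\<Prod>i\<in>UNIV. exp (- (x $ i)\<^sup>2 / 2))" for x :: "real ^ 'n"
    by (simp add: exp_sum[symmetric] inner_vec_def sum_negf sum_divide_distrib power2_eq_square)
  have split_c: "of_real (exp (- (x \<bullet> x) / 2)) * cis (x \<bullet> w)
      = (\<Prod>i\<in>UNIV. of_real (exp (- (x $ i)\<^sup>2 / 2)) * cis (x $ i * w $ i))" for x :: "real ^ 'n"
  proof -
    have "cis (x \<bullet> w) = (\<Prod>i\<in>UNIV. cis (x $ i * w $ i))"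
      by (simp add: inner_vec_def cis_conv_exp exp_sum[symmetric] sum_distrib_left)
    then show ?thesis
      unfolding split_r by (simp add: prod.distrib)
  qed
  show "integrable lborel (\<lambda>x::real ^ 'n. exp (- (x \<bullet> x) / 2))"
    unfolding split_r by (rule integrable_coordinate_product) (rule ir)
  have "integral\<^sup>L lborel (\<lambda>t::real. exp (- t\<^sup>2 / 2)) = sqrt (2 * pi)"
    unfolding norm using integral_std_normal_moment_even[of 0] by simp
  then show "integral\<^sup>L lborel (\<lambda>x::real ^ 'n. exp (- (x \<bullet> x) / 2)) = sqrt (2 * pi) ^ CARD('n)"
    unfolding split_r by (subst integral_coordinate_product) (use ir in auto)
  have "(\<integral>x. of_real (exp (- (x \<bullet> x) / 2)) * cis (x \<bullet> w) \<partial>lborel)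
      = (\<Prod>i\<in>UNIV. \<integral>t. of_real (exp (- t\<^sup>2 / 2)) * cis (t * w $ i) \<partial>lborel)"
    unfolding split_c by (rule integral_coordinate_product[OF ic])
  also have "\<dots> = of_real (sqrt (2 * pi) ^ CARD('n) * exp (- (w \<bullet> w) / 2))"
    unfolding f1 split_r by (simp add: prod.distrib)
  finally show "(\<integral>x. of_real (exp (- (x \<bullet> x) / 2)) * cis (x \<bullet> w) \<partial>lborel)
      = of_real (sqrt (2 * pi) ^ CARD('n) * exp (- (w \<bullet> w) / 2))" .
qed

section \<open>Fourier inversion\<close>

definition inverse_fourier :: "(real ^ 'n::finite \<Rightarrow> complex) \<Rightarrow> real ^ 'n \<Rightarrow> complex" where
  "inverse_fourier h x = (\<integral>\<eta>. h \<eta> * cis (2 * pi * (x \<bullet> \<eta>)) \<partial>lborel)"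

lemma integrable_mult_cis:
  fixes h :: "'a::euclidean_space \<Rightarrow> complex"
  assumes "integrable lborel h" and [measurable]: "a \<in> borel_measurable borel"
  shows "integrable lborel (\<lambda>x. h x * cis (a x))"
  by (rule Bochner_Integration.integrable_bound[OF assms(1)])
     (use borel_measurable_integrable[OF assms(1)] in \<open>auto simp: norm_mult\<close>)

lemma integrable_tensor:
  fixes f :: "'a::euclidean_space \<Rightarrow> complex" and g :: "'b::euclidean_space \<Rightarrow> complex"
  assumes f: "integrable lborel f" and g: "integrable lborel g"
  shows "integrable (lborel \<Otimes>\<^sub>M lborel) (\<lambda>(x, y). f x * g y)"
proof (rule lborel_pair.Fubini_integrable)
  have [measurable]: "f \<in> borel_measurable lborel" "g \<in> borel_measurable lborel"
    using f g by auto
  show "(\<lambda>(x, y). f x * g y) \<in> borel_measurable (lborel \<Otimes>\<^sub>M lborel)"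
    by measurable
  show "integrable lborel (\<lambda>x. \<integral>y. norm (case (x, y) of (x, y) \<Rightarrow> f x * g y) \<partial>lborel)"
    using f by (auto simp: norm_mult)
  show "AE x in lborel. integrable lborel (\<lambda>y. case (x, y) of (x, y) \<Rightarrow> f x * g y)"
    using g by auto
qed

lemma gaussian_fourier_scaled:
  fixes v :: "real ^ 'n::finite"
  assumes e: "e > 0"
  shows "(\<integral>x. of_real (exp (- (((2 * pi * e) *\<^sub>R x) \<bullet> ((2 * pi * e) *\<^sub>R x)) / 2)) * cis (2 * pi * (x \<bullet> v)) \<partial>lborel)
     = of_real (exp (- ((v /\<^sub>R e) \<bullet> (v /\<^sub>R e)) / 2) / (e ^ CARD('n) * sqrt (2 * pi) ^ CARD('n)))"
proof -
  define f where "f y = of_real (exp (- (y \<bullet> y) / 2)) * cis (y \<bullet> (v /\<^sub>R e))" for y :: "real ^ 'n"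
  have f: "integrable lborel f"
    unfolding f_def by (intro integrable_mult_cis integrable_of_real integrable_gaussian) auto
  have c: "2 * pi * e \<noteq> 0" using e by simp
  have "of_real (sqrt (2 * pi) ^ CARD('n) * exp (- ((v /\<^sub>R e) \<bullet> (v /\<^sub>R e)) / 2)) = (\<integral>y. f y \<partial>lborel)"
    unfolding f_def by (rule gaussian_fourier[symmetric])
  also have "\<dots> = (2 * pi * e) ^ CARD('n) *\<^sub>R (\<integral>x. f (0 + (2 * pi * e) *\<^sub>R x) \<partial>lborel)"
    using integral_lborel_affine[OF c f, of 0] e by simp
  also have "(\<lambda>x. f (0 + (2 * pi * e) *\<^sub>R x)) =
      (\<lambda>x. of_real (exp (- (((2 * pi * e) *\<^sub>R x) \<bullet> ((2 * pi * e) *\<^sub>R x)) / 2)) * cis (2 * pi * (x \<bullet> v)))"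
  proof -
    have "(0 + (2 * pi * e) *\<^sub>R x) \<bullet> (v /\<^sub>R e) = 2 * pi * (x \<bullet> v)" for x
      using e by (simp add: field_simps)
    then show ?thesis
      unfolding f_def by (simp only: add_0_left)
  qed
  finally have "(\<integral>x. of_real (exp (- (((2 * pi * e) *\<^sub>R x) \<bullet> ((2 * pi * e) *\<^sub>R x)) / 2)) * cis (2 * pi * (x \<bullet> v)) \<partial>lborel)
     = of_real (sqrt (2 * pi) ^ CARD('n) * exp (- ((v /\<^sub>R e) \<bullet> (v /\<^sub>R e)) / 2) / (2 * pi * e) ^ CARD('n))"
    using e by (simp add: scaleR_conv_of_real field_simps del: of_real_mult)
  (* half of the powers of 2 pi cancel against the Gaussian normalisation *)
  moreover have "(2 * pi * e) ^ CARD('n) = sqrt (2 * pi) ^ CARD('n) * (e ^ CARD('n) * sqrt (2 * pi) ^ CARD('n))"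
  proof -
    have "2 * pi * e = sqrt (2 * pi) * (e * sqrt (2 * pi))"
      using real_sqrt_mult_self[of "2 * pi"] by (simp add: mult_ac)
    then show ?thesis
      by (simp only: power_mult_distrib)
  qed
  ultimately show ?thesis
    using e by simp
qed

text \<open>With a Gaussian factor the double integral converges absolutely. Fubini and the transform of
  the Gaussian then turn the integral of the inverse transform into an average of \<open>h\<close> around \<open>\<xi>\<close> at
  scale \<open>e\<close>.\<close>
lemma regularised_inversion:
  fixes h :: "real ^ 'n::finite \<Rightarrow> complex"
  assumes h: "integrable lborel h" and e: "e > 0"
  shows "(\<integral>x. inverse_fourier h x * cis (- 2 * pi * (x \<bullet> \<xi>)) *
             of_real (exp (- (((2 * pi * e) *\<^sub>R x) \<bullet> ((2 * pi * e) *\<^sub>R x)) / 2)) \<partial>lborel)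
     = (\<integral>u. h (\<xi> + e *\<^sub>R u) * of_real (exp (- (u \<bullet> u) / 2)) \<partial>lborel) / of_real (sqrt (2 * pi) ^ CARD('n))"
proof -
  define E where "E x = exp (- (((2 * pi * e) *\<^sub>R x) \<bullet> ((2 * pi * e) *\<^sub>R x)) / 2)" for x :: "real ^ 'n"
  define s where "s = e ^ CARD('n) * sqrt (2 * pi) ^ CARD('n)"
  have s: "s > 0" using e by (simp add: s_def)
  define F where "F x \<eta> = (of_real (E x) * h \<eta>) * cis (2 * pi * (x \<bullet> (\<eta> - \<xi>)))" for x \<eta>
  have [measurable]: "h \<in> borel_measurable borel"
    using borel_measurable_integrable[OF h] by simp
  have iE: "integrable lborel E"
    unfolding E_def
    using integrable_lborel_affine[where t=0 and c="2 * pi * e", OF _ integrable_gaussian[where 'n='n]] e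
    by simp
  have [measurable]: "E \<in> borel_measurable borel"
    using borel_measurable_integrable[OF iE] by simp
  have "integrable (lborel \<Otimes>\<^sub>M lborel) (\<lambda>(x, \<eta>). of_real (E x) * h \<eta>)"
    by (intro integrable_tensor integrable_of_real iE h)
  then have F: "integrable (lborel \<Otimes>\<^sub>M lborel) (case_prod F)"
    by (rule Bochner_Integration.integrable_bound) (auto simp: F_def[abs_def] norm_mult)
  have i: "integrable lborel (\<lambda>\<eta>. h \<eta> * of_real (exp (- (((\<eta> - \<xi>) /\<^sub>R e) \<bullet> ((\<eta> - \<xi>) /\<^sub>R e)) / 2) / s))"
  proof (rule Bochner_Integration.integrable_bound)
    show "integrable lborel (\<lambda>\<eta>. h \<eta> * of_real (1 / s))"
      using h by simp
    have "norm (h \<eta>) * \<bar>exp (- (((\<eta> - \<xi>) /\<^sub>R e) \<bullet> ((\<eta> - \<xi>) /\<^sub>R e)) / 2) / s\<bar> \<le> norm (h \<eta>) * \<bar>1 / s\<bar>" for \<eta>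
      using s by (intro mult_left_mono) (auto simp: divide_right_mono simp del: inner_scaleR_left inner_scaleR_right)
    then show "AE \<eta> in lborel. norm (h \<eta> * of_real (exp (- (((\<eta> - \<xi>) /\<^sub>R e) \<bullet> ((\<eta> - \<xi>) /\<^sub>R e)) / 2) / s))
        \<le> norm (h \<eta> * of_real (1 / s))"
      by (intro AE_I2) (simp only: norm_mult norm_of_real)
  qed auto
  have "(\<integral>x. inverse_fourier h x * cis (- 2 * pi * (x \<bullet> \<xi>)) * of_real (E x) \<partial>lborel)
      = (\<integral>x. (\<integral>\<eta>. F x \<eta> \<partial>lborel) \<partial>lborel)"
  proof (rule Bochner_Integration.integral_cong[OF refl])
    fix x
    have "inverse_fourier h x * (cis (- 2 * pi * (x \<bullet> \<xi>)) * of_real (E x)) =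
      (\<integral>\<eta>. (h \<eta> * cis (2 * pi * (x \<bullet> \<eta>))) * (cis (- 2 * pi * (x \<bullet> \<xi>)) * of_real (E x)) \<partial>lborel)"
      unfolding inverse_fourier_def by simp
    also have "\<dots> = (\<integral>\<eta>. F x \<eta> \<partial>lborel)"
      by (intro Bochner_Integration.integral_cong)
         (auto simp: F_def inner_diff_right right_diff_distrib cis_mult[symmetric] cis_divide[symmetric]
               cis_inverse[symmetric] divide_simps)
    finally show "inverse_fourier h x * cis (- 2 * pi * (x \<bullet> \<xi>)) * of_real (E x) = (\<integral>\<eta>. F x \<eta> \<partial>lborel)"
      by (simp add: mult.assoc)
  qed
  also have "\<dots> = (\<integral>\<eta>. (\<integral>x. F x \<eta> \<partial>lborel) \<partial>lborel)"
    by (rule lborel_pair.Fubini_integral[OF F, symmetric])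
  also have "\<dots> = (\<integral>\<eta>. h \<eta> * of_real (exp (- (((\<eta> - \<xi>) /\<^sub>R e) \<bullet> ((\<eta> - \<xi>) /\<^sub>R e)) / 2) / s) \<partial>lborel)"
  proof (rule Bochner_Integration.integral_cong[OF refl])
    fix \<eta>
    have "(\<integral>x. F x \<eta> \<partial>lborel) = (\<integral>x. h \<eta> * (of_real (E x) * cis (2 * pi * (x \<bullet> (\<eta> - \<xi>)))) \<partial>lborel)"
      by (intro Bochner_Integration.integral_cong) (auto simp: F_def)
    then show "(\<integral>x. F x \<eta> \<partial>lborel) = h \<eta> * of_real (exp (- (((\<eta> - \<xi>) /\<^sub>R e) \<bullet> ((\<eta> - \<xi>) /\<^sub>R e)) / 2) / s)"
      unfolding E_def by (simp only: integral_mult_right_zero gaussian_fourier_scaled[OF e] s_def)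
  qed
  also have "\<dots> = e ^ CARD('n) *\<^sub>R (\<integral>u. h (\<xi> + e *\<^sub>R u) * of_real (exp (- (u \<bullet> u) / 2) / s) \<partial>lborel)"
    using integral_lborel_affine[OF _ i, of e \<xi>] e by simp
  also have "\<dots> = (\<integral>u. h (\<xi> + e *\<^sub>R u) * of_real (exp (- (u \<bullet> u) / 2)) \<partial>lborel) / of_real (sqrt (2 * pi) ^ CARD('n))"
    using e by (simp add: s_def scaleR_conv_of_real field_simps)
  finally show ?thesis
    unfolding E_def .
qed

text \<open>Let the scale tend to \<open>0\<close> in the regularised identity. Dominated convergence applies on the
  left since the inverse transform is integrable, and on the right since \<open>h\<close> is bounded.\<close>
lemma fourier_inversion:
  fixes h :: "real ^ 'n::finite \<Rightarrow> complex"
  assumes cont: "continuous_on UNIV h" and bound: "\<And>x. norm (h x) \<le> B"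
    and h: "integrable lborel h" and hh: "integrable lborel (inverse_fourier h)"
  shows "(\<integral>x. inverse_fourier h x * cis (- 2 * pi * (x \<bullet> \<xi>)) \<partial>lborel) = h \<xi>"
proof -
  define e where "e m = 1 / real (Suc m)" for m
  have e: "e m > 0" for m by (simp add: e_def)
  have e0: "e \<longlonglongrightarrow> 0"
    unfolding e_def by (rule LIMSEQ_Suc[OF lim_1_over_n])
  have [measurable]: "h \<in> borel_measurable borel" "inverse_fourier h \<in> borel_measurable borel"
    using borel_measurable_integrable[OF h] borel_measurable_integrable[OF hh] by simp_all
  let ?L = "\<lambda>m x. inverse_fourier h x * cis (- 2 * pi * (x \<bullet> \<xi>)) *
             of_real (exp (- (((2 * pi * e m) *\<^sub>R x) \<bullet> ((2 * pi * e m) *\<^sub>R x)) / 2))"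
  let ?R = "\<lambda>m u. h (\<xi> + e m *\<^sub>R u) * of_real (exp (- (u \<bullet> u) / 2))"
  have "(\<lambda>m. \<integral>x. ?L m x \<partial>lborel) \<longlonglongrightarrow> (\<integral>x. inverse_fourier h x * cis (- 2 * pi * (x \<bullet> \<xi>)) \<partial>lborel)"
  proof (rule integral_dominated_convergence)
    show "integrable lborel (\<lambda>x. norm (inverse_fourier h x))"
      using hh by simp
    show "AE x in lborel. (\<lambda>m. ?L m x) \<longlonglongrightarrow> inverse_fourier h x * cis (- 2 * pi * (x \<bullet> \<xi>))"
    proof (rule AE_I2)
      fix x
      have "(\<lambda>m. ?L m x) \<longlonglongrightarrow> inverse_fourier h x * cis (- 2 * pi * (x \<bullet> \<xi>)) *
             of_real (exp (- (((2 * pi * 0) *\<^sub>R x) \<bullet> ((2 * pi * 0) *\<^sub>R x)) / 2))"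
        by (intro tendsto_intros e0) auto
      then show "(\<lambda>m. ?L m x) \<longlonglongrightarrow> inverse_fourier h x * cis (- 2 * pi * (x \<bullet> \<xi>))"
        by simp
    qed
    show "AE x in lborel. norm (?L m x) \<le> norm (inverse_fourier h x)" for m
      by (intro AE_I2) (auto simp: norm_mult less_imp_le[OF e] intro!: mult_left_le)
  qed auto
  moreover have "(\<lambda>m. \<integral>u. ?R m u \<partial>lborel) \<longlonglongrightarrow> (integral\<^sup>L lborel (\<lambda>u::real ^ 'n. h \<xi> * of_real (exp (- (u \<bullet> u) / 2))))"
  proof (rule integral_dominated_convergence)
    show "integrable lborel (\<lambda>u::real ^ 'n. B * exp (- (u \<bullet> u) / 2))"
      by (intro integrable_mult_right integrable_gaussian)
    show "AE u in lborel. (\<lambda>m. ?R m u) \<longlonglongrightarrow> h \<xi> * of_real (exp (- (u \<bullet> u) / 2))"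
    proof (rule AE_I2)
      fix u
      have "(\<lambda>m. \<xi> + e m *\<^sub>R u) \<longlonglongrightarrow> \<xi> + 0 *\<^sub>R u"
        by (intro tendsto_intros e0)
      then have "(\<lambda>m. h (\<xi> + e m *\<^sub>R u)) \<longlonglongrightarrow> h \<xi>"
        using continuous_on_tendsto_compose[OF cont, of "\<lambda>m. \<xi> + e m *\<^sub>R u" \<xi>] by simp
      then show "(\<lambda>m. ?R m u) \<longlonglongrightarrow> h \<xi> * of_real (exp (- (u \<bullet> u) / 2))"
        by (intro tendsto_intros)
    qed
    show "AE u in lborel. norm (?R m u) \<le> B * exp (- (u \<bullet> u) / 2)" for m
      by (intro AE_I2) (auto simp: norm_mult bound)
  qed auto
  then have "(\<lambda>m. (\<integral>u. ?R m u \<partial>lborel) / of_real (sqrt (2 * pi) ^ CARD('n))) \<longlonglongrightarrow>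
      (integral\<^sup>L lborel (\<lambda>u::real ^ 'n. h \<xi> * of_real (exp (- (u \<bullet> u) / 2)))) / of_real (sqrt (2 * pi) ^ CARD('n))"
    by (intro tendsto_intros) auto
  moreover have "(integral\<^sup>L lborel (\<lambda>u::real ^ 'n. h \<xi> * of_real (exp (- (u \<bullet> u) / 2)))) = h \<xi> * of_real (sqrt (2 * pi) ^ CARD('n))"
    by (simp only: integral_mult_right_zero integral_complex_of_real gaussian_integral)
  ultimately show ?thesis
    unfolding regularised_inversion[OF h e]
    by (auto intro: LIMSEQ_unique)
qed

section \<open>Decay of inverse Fourier transforms\<close>

abbreviation has_partial_derivative ::
    "'n::finite \<Rightarrow> (real ^ 'n \<Rightarrow> complex) \<Rightarrow> complex \<Rightarrow> real ^ 'n \<Rightarrow> bool" where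
  "has_partial_derivative i u d x \<equiv>
     ((\<lambda>t. u (x + t *\<^sub>R axis i 1)) has_vector_derivative d) (at 0)"

lemma integrable_compact_support:
  fixes u :: "'a::euclidean_space \<Rightarrow> complex"
  assumes "continuous_on UNIV u" and "\<And>x. r < norm x \<Longrightarrow> u x = 0"
  shows "integrable lborel u"
proof -
  have "integrable lborel (\<lambda>x. indicator (cball 0 r) x *\<^sub>R u x)"
    by (rule borel_integrable_compact) (auto intro: continuous_on_subset[OF assms(1)])
  moreover have "(\<lambda>x. indicator (cball 0 r) x *\<^sub>R u x) = u"
    using assms(2) by (force simp: indicator_def not_le)
  ultimately show ?thesis by simp
qed

lemma bounded_compact_support:
  fixes u :: "'a::euclidean_space \<Rightarrow> complex"
  assumes "continuous_on UNIV u" and "\<And>x. r < norm x \<Longrightarrow> u x = 0"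
  obtains M where "\<And>x. norm (u x) \<le> M" "0 \<le> M"
proof -
  have "bounded (u ` cball 0 r)"
    by (intro compact_imp_bounded compact_continuous_image continuous_on_subset[OF assms(1)]) auto
  then obtain M where M: "\<And>x. x \<in> cball 0 r \<Longrightarrow> norm (u x) \<le> M"
    unfolding bounded_iff by blast
  have "norm (u x) \<le> max M 0" for x
  proof (cases "r < norm x")
    case True
    then show ?thesis using assms(2) by simp
  next
    case False
    then show ?thesis using M[of x] by simp
  qed
  then show ?thesis
    using that[of "max M 0"] by simp
qed

text \<open>By translation invariance every difference quotient of \<open>u\<close> in direction \<open>i\<close> has integral \<open>0\<close>.
  These quotients are dominated by a bound of \<open>u'\<close> on a fixed ball and converge to \<open>u'\<close>.\<close>
lemma integral_partial_derivative_eq_0: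
  fixes u :: "real ^ 'n::finite \<Rightarrow> complex"
  assumes u: "continuous_on UNIV u" "\<And>x. r < norm x \<Longrightarrow> u x = 0"
    and u': "continuous_on UNIV u'" "\<And>x. r < norm x \<Longrightarrow> u' x = 0"
    and D: "\<And>x. has_partial_derivative i u (u' x) x"
  shows "(\<integral>x. u' x \<partial>lborel) = 0"
proof -
  define e where "e m = 1 / real (Suc m)" for m
  have e: "e m > 0" "e m \<le> 1" for m by (auto simp: e_def)
  have e0: "e \<longlonglongrightarrow> 0"
    unfolding e_def by (rule LIMSEQ_Suc[OF lim_1_over_n])
  let ?v = "axis i 1 :: real ^ 'n"
  let ?q = "\<lambda>m x. (u (x + e m *\<^sub>R ?v) - u x) /\<^sub>R e m"
  have [measurable]: "u \<in> borel_measurable borel" "u' \<in> borel_measurable borel"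
    using u(1) u'(1) by (auto intro: borel_measurable_continuous_onI)
  have iu: "integrable lborel u"
    by (rule integrable_compact_support[OF u])
  obtain M where M: "\<And>x. norm (u' x) \<le> M" "0 \<le> M"
    using bounded_compact_support[OF u'] by blast
  (* the derivative at s along the line through x is the one at 0 along the line through x + s v *)
  have Ds: "((\<lambda>t. u (x + t *\<^sub>R ?v)) has_vector_derivative u' (x + s *\<^sub>R ?v)) (at s)" for x s
  proof -
    have "(((\<lambda>t. u ((x + s *\<^sub>R ?v) + t *\<^sub>R ?v)) \<circ> (\<lambda>t. t - s)) has_vector_derivative
        1 *\<^sub>R u' (x + s *\<^sub>R ?v)) (at s)"
      by (rule vector_diff_chain_at) (auto intro!: derivative_eq_intros D)
    then show ?thesis
      by (simp add: o_def algebra_simps)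
  qed
  have lip: "norm (u (x + t *\<^sub>R ?v) - u x) \<le> M * t" if "t > 0" for x t
  proof -
    have "continuous_on {0..t} (\<lambda>t. u (x + t *\<^sub>R ?v))"
      by (intro continuous_at_imp_continuous_on ballI differentiable_imp_continuous_within
          differentiableI_vector[OF Ds])
    from mvt_general[OF that this Ds[unfolded has_vector_derivative_def]]
    obtain s where "norm (u (x + t *\<^sub>R ?v) - u (x + 0 *\<^sub>R ?v)) \<le> norm ((t - 0) *\<^sub>R u' (x + s *\<^sub>R ?v))"
      by blast
    also have "\<dots> \<le> M * t"
      using M(1) that by (auto simp: mult.commute intro: mult_right_mono)
    finally show ?thesis by simp
  qed
  have "(\<lambda>m. \<integral>x. ?q m x \<partial>lborel) \<longlonglongrightarrow> (\<integral>x. u' x \<partial>lborel)"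
  proof (rule integral_dominated_convergence)
    show "integrable lborel (\<lambda>x::real ^ 'n. indicator (cball 0 (r + 1)) x *\<^sub>R M)"
      by (rule borel_integrable_compact) auto
    show "AE x in lborel. (\<lambda>m. ?q m x) \<longlonglongrightarrow> u' x"
    proof (rule AE_I2)
      fix x
      have "((\<lambda>h. (u (x + h *\<^sub>R ?v) - u x) /\<^sub>R h) \<longlongrightarrow> u' x) (at 0)"
      proof -
        have lim: "((\<lambda>h. norm (u (x + h *\<^sub>R ?v) - u x - h *\<^sub>R u' x) / \<bar>h\<bar>) \<longlongrightarrow> 0) (at 0)"
          using D[of x] by (simp add: has_vector_derivative_def has_derivative_iff_norm)
        have "norm (a - h *\<^sub>R d) / \<bar>h\<bar> = norm (a /\<^sub>R h - d)" if "h \<noteq> 0" for a d :: complex and h :: real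
        proof -
          have "a /\<^sub>R h - d = (a - h *\<^sub>R d) /\<^sub>R h"
            using that by (simp add: scaleR_diff_right)
          then show ?thesis
            by (simp add: divide_inverse mult.commute)
        qed
        then have "\<forall>\<^sub>F h in at 0. norm (u (x + h *\<^sub>R ?v) - u x - h *\<^sub>R u' x) / \<bar>h\<bar> =
            norm ((u (x + h *\<^sub>R ?v) - u x) /\<^sub>R h - u' x)"
          by (auto simp: eventually_at_filter)
        then have "((\<lambda>h. norm ((u (x + h *\<^sub>R ?v) - u x) /\<^sub>R h - u' x)) \<longlongrightarrow> 0) (at 0)"
          by (rule Lim_transform_eventually[OF lim])
        then show ?thesis
          unfolding tendsto_norm_zero_iff by (simp add: LIM_zero_iff)
      qed

      moreover have "filterlim e (at 0) sequentially"
      proof -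
        have "e m \<noteq> 0" for m using e(1)[of m] by simp
        then show ?thesis
          using e0 by (simp add: filterlim_at)
      qed
      ultimately show "(\<lambda>m. ?q m x) \<longlonglongrightarrow> u' x"
        by (rule filterlim_compose)
    qed
    show "AE x in lborel. norm (?q m x) \<le> indicator (cball 0 (r + 1)) x *\<^sub>R M" for m
    proof (rule AE_I2)
      fix x
      have "norm (u (x + e m *\<^sub>R ?v) - u x) \<le> M * e m"
        by (rule lip[OF e(1)])
      moreover have "norm (?q m x) = norm (u (x + e m *\<^sub>R ?v) - u x) / e m"
        using e(1)[of m] by (simp add: divide_inverse mult.commute)
      ultimately have 1: "norm (?q m x) \<le> M"
        using e(1)[of m] by (simp add: pos_divide_le_eq)
      have 2: "?q m x = 0" if "norm x > r + 1"
      proof -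
        have "norm x - norm (e m *\<^sub>R ?v) \<le> norm (x + e m *\<^sub>R ?v)"
          by (metis norm_diff_ineq)
        then have "r < norm (x + e m *\<^sub>R ?v)"
          using that e[of m] by simp
        then show ?thesis
          using that u(2) by simp
      qed
      show "norm (?q m x) \<le> indicator (cball 0 (r + 1)) x *\<^sub>R M"
        using 1 2 by (cases "norm x > r + 1") (auto simp: indicator_def)
    qed
  qed measurable
  moreover have q0: "(\<integral>x. ?q m x \<partial>lborel) = 0" for m
  proof -
    have i: "integrable lborel (\<lambda>x. u (x + e m *\<^sub>R ?v))"
      using integrable_lborel_affine[OF _ iu, of 1 "e m *\<^sub>R ?v"] by (simp add: add.commute)
    have "(\<integral>x. u (x + e m *\<^sub>R ?v) \<partial>lborel) = (\<integral>x. u x \<partial>lborel)"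
      using integral_lborel_affine[OF _ iu, of 1 "e m *\<^sub>R ?v"] by (simp add: add.commute)
    then show ?thesis
      using i iu by simp
  qed
  ultimately show ?thesis
    by (simp only: q0 LIMSEQ_const_iff)
qed

text \<open>Integration by parts: the function \<open>u \<eta> * cis (2 * pi * (x \<bullet> \<eta>))\<close> of \<open>\<eta>\<close> has compact support,
  so its derivative integrates to \<open>0\<close>.\<close>
lemma inverse_fourier_partial_derivative:
  fixes u :: "real ^ 'n::finite \<Rightarrow> complex"
  assumes u: "continuous_on UNIV u" "\<And>x. r < norm x \<Longrightarrow> u x = 0"
    and u': "continuous_on UNIV u'" "\<And>x. r < norm x \<Longrightarrow> u' x = 0"
    and D: "\<And>x. has_partial_derivative i u (u' x) x"
  shows "inverse_fourier u' x = - (2 * pi * \<i> * x $ i) * inverse_fourier u x"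
proof -
  let ?c = "\<lambda>\<eta>. cis (2 * pi * (x \<bullet> \<eta>))"
  define w where "w \<eta> = u \<eta> * ?c \<eta>" for \<eta>
  define w' where "w' \<eta> = u' \<eta> * ?c \<eta> + (2 * pi * \<i> * x $ i) * w \<eta>" for \<eta>
  have "(\<integral>\<eta>. w' \<eta> \<partial>lborel) = 0"
  proof (rule integral_partial_derivative_eq_0)
    show "continuous_on UNIV w" "continuous_on UNIV w'"
      unfolding w'_def w_def by (intro continuous_intros u u')+
    show "w \<eta> = 0" "w' \<eta> = 0" if "r < norm \<eta>" for \<eta>
      using u(2)[OF that] u'(2)[OF that] by (simp_all add: w_def w'_def)
    fix \<eta>
    have lin: "2 * pi * (x \<bullet> (\<eta> + t *\<^sub>R axis i 1)) = 2 * pi * (x \<bullet> \<eta>) + t * (2 * pi * x $ i)" for t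
      by (simp add: inner_add_right inner_axis algebra_simps)
    have "((\<lambda>t. cis (2 * pi * (x \<bullet> \<eta>) + t * (2 * pi * x $ i))) has_vector_derivative
        (2 * pi * x $ i) *\<^sub>R (\<i> * cis (2 * pi * (x \<bullet> \<eta>)))) (at 0)"
      unfolding has_vector_derivative_def by (auto intro!: derivative_eq_intros)
    with D[of \<eta>] have "((\<lambda>t. u (\<eta> + t *\<^sub>R axis i 1) * ?c (\<eta> + t *\<^sub>R axis i 1)) has_vector_derivative
       u (\<eta> + 0 *\<^sub>R axis i 1) * ((2 * pi * x $ i) *\<^sub>R (\<i> * ?c \<eta>)) + u' \<eta> * ?c (\<eta> + 0 *\<^sub>R axis i 1)) (at 0)"
      unfolding lin by (rule has_vector_derivative_mult)
    then show "has_partial_derivative i w (w' \<eta>) \<eta>"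
      by (simp add: w_def w'_def scaleR_conv_of_real algebra_simps)
  qed
  moreover have "integrable lborel (\<lambda>\<eta>. u' \<eta> * ?c \<eta>)"
    by (intro integrable_mult_cis integrable_compact_support[OF u']) auto
  moreover have "integrable lborel w"
    unfolding w_def by (intro integrable_mult_cis integrable_compact_support[OF u]) auto
  ultimately have "inverse_fourier u' x + (2 * pi * \<i> * x $ i) * inverse_fourier u x = 0"
    unfolding w'_def inverse_fourier_def w_def by simp
  then show ?thesis
    by (simp add: eq_neg_iff_add_eq_0)
qed

text \<open>The successive derivatives in direction \<open>i\<close> are kept as an explicit sequence \<open>D 0, \<dots>, D N\<close>,
  not generated by iterating \<^const>\<open>partial\<close>, because the bounds and supports of products and
  dilations are read off from their formulas.\<close>
definition partial_derivative_chain ::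
    "'n::finite \<Rightarrow> nat \<Rightarrow> (real ^ 'n) set \<Rightarrow> (nat \<Rightarrow> real ^ 'n \<Rightarrow> complex) \<Rightarrow> bool" where
  "partial_derivative_chain i N S D \<longleftrightarrow>
     (\<forall>k\<le>N. continuous_on S (D k)) \<and>
     (\<forall>k<N. \<forall>x\<in>S. has_partial_derivative i (D k) (D (Suc k) x) x)"

lemma inverse_fourier_chain:
  fixes D :: "nat \<Rightarrow> real ^ 'n::finite \<Rightarrow> complex"
  assumes chain: "partial_derivative_chain i N UNIV D"
    and supp: "\<And>k x. k \<le> N \<Longrightarrow> r < norm x \<Longrightarrow> D k x = 0"
    and "k \<le> N"
  shows "inverse_fourier (D k) x = (- (2 * pi * \<i> * x $ i)) ^ k * inverse_fourier (D 0) x"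
  using \<open>k \<le> N\<close>
proof (induction k)
  case (Suc k)
  have "inverse_fourier (D (Suc k)) x = - (2 * pi * \<i> * x $ i) * inverse_fourier (D k) x"
    by (rule inverse_fourier_partial_derivative[where r=r])
       (use chain supp Suc.prems in \<open>auto simp: partial_derivative_chain_def\<close>)
  with Suc show ?case
    by simp
qed simp

lemma norm_inverse_fourier_le:
  fixes u :: "real ^ 'n::finite \<Rightarrow> complex"
  assumes u: "continuous_on UNIV u" and supp: "\<And>x. r < norm x \<Longrightarrow> u x = 0"
    and A: "\<And>x. norm (u x) \<le> A"
  shows "norm (inverse_fourier u x) \<le> A * measure lborel (cball (0 :: real ^ 'n) r)"
proof -
  have "norm (inverse_fourier u x) \<le> (\<integral>\<eta>. norm (u \<eta> * cis (2 * pi * (x \<bullet> \<eta>))) \<partial>lborel)"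
    unfolding inverse_fourier_def by (rule integral_norm_bound)
  also have "\<dots> \<le> (\<integral>\<eta>. A * indicator (cball 0 r) \<eta> \<partial>(lborel :: (real ^ 'n) measure))"
  proof (rule integral_mono)
    show "integrable lborel (\<lambda>\<eta>. norm (u \<eta> * cis (2 * pi * (x \<bullet> \<eta>))))"
      by (intro integrable_norm integrable_mult_cis integrable_compact_support[OF u supp]) auto
    show "integrable lborel (\<lambda>\<eta>::real ^ 'n. A * indicator (cball 0 r) \<eta>)"
      by (intro integrable_mult_right integrable_real_indicator) (simp_all add: emeasure_lborel_cball_finite[simplified])
    show "norm (u \<eta> * cis (2 * pi * (x \<bullet> \<eta>))) \<le> A * indicator (cball 0 r) \<eta>" for \<eta>
      using A[of \<eta>] supp[of \<eta>] by (auto simp: norm_mult indicator_def)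
  qed
  finally show ?thesis by simp
qed

text \<open>A tensor product is used in place of a power of \<open>1 + norm x\<close> because its integral factors
  into integrals over the line.\<close>
definition decay_weight :: "real \<Rightarrow> real ^ 'n::finite \<Rightarrow> real" where
  "decay_weight p x = (\<Prod>i\<in>UNIV. (1 + \<bar>x $ i\<bar>) powr (- p))"

lemma integrable_decay_weight:
  assumes p: "p > 1"
  shows "integrable lborel (decay_weight p :: real ^ 'n::finite \<Rightarrow> real)"
proof -
  define q where "q t = (1 + t) powr (- p) * indicator {0..} t" for t :: real
  define F where "F t = - ((1 + t) powr (1 - p) / (p - 1))" for t :: real
  have "(\<integral>\<^sup>+t. ennreal (q t) \<partial>lborel) = (\<integral>\<^sup>+t. ennreal ((1 + t) powr (- p)) * indicator {0..} t \<partial>lborel)"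
    by (intro nn_integral_cong) (auto simp: q_def indicator_def)
  also have "\<dots> = ennreal (0 - F 0)"
  proof (rule nn_integral_FTC_atLeast)
    show "(F has_real_derivative (1 + x) powr (- p)) (at x)" if "0 \<le> x" for x
      proof -
      have "- ((1 - p) * y / (p - 1)) = y" for y
        using p by (simp add: divide_simps) (simp add: algebra_simps)
      then show ?thesis
        unfolding F_def using that p by (auto intro!: derivative_eq_intros)
    qed
    show "(F \<longlongrightarrow> 0) at_top"
    proof -
      have "filterlim (\<lambda>t::real. 1 + t) at_top at_top"
        by (intro filterlim_tendsto_add_at_top[OF tendsto_const] filterlim_ident)
      then have "((\<lambda>t. (1 + t) powr (1 - p)) \<longlongrightarrow> 0) at_top"
        using p by (intro tendsto_neg_powr) auto
      then have "(F \<longlongrightarrow> - (0 / (p - 1))) at_top"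
        unfolding F_def using p by (intro tendsto_intros) auto
      then show ?thesis by simp
    qed
  qed auto
  finally have q: "integrable lborel q"
    by (intro integrableI_bounded) (auto simp: q_def[abs_def] abs_mult)
  have "integrable lborel (\<lambda>t. q t + q (0 + (-1) * t))"
    using q lborel_integrable_real_affine[OF q, of "-1" 0] by (intro Bochner_Integration.integrable_add) auto
  then have "integrable lborel (\<lambda>t::real. (1 + \<bar>t\<bar>) powr (- p))"
    by (rule Bochner_Integration.integrable_bound) (auto simp: q_def indicator_def)
  then show ?thesis
    unfolding decay_weight_def by (intro integrable_coordinate_product)
qed

lemma decay_weight_nonneg: "decay_weight p x \<ge> 0"
  by (auto simp: decay_weight_def intro: prod_nonneg)

text \<open>Integrating by parts \<open>N\<close> times in direction \<open>i\<close> bounds the inverse transform by a constant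
  times \<open>(1 + \<bar>x $ i\<bar>) powr (- N)\<close>, for each \<open>i\<close> separately. The geometric mean of these
  \<open>CARD('n)\<close> bounds is the tensor weight with exponent \<open>N / CARD('n)\<close>, which is integrable as soon
  as \<open>N > CARD('n)\<close>.\<close>
lemma inverse_fourier_decay:
  fixes h :: "real ^ 'n::finite \<Rightarrow> complex"
  assumes A: "A \<ge> 0"
    and smooth: "\<And>i. \<exists>D. partial_derivative_chain i N UNIV D \<and> D 0 = h \<and>
        (\<forall>k\<le>N. \<forall>x. (r < norm x \<longrightarrow> D k x = 0) \<and> norm (D k x) \<le> A)"
  shows "norm (inverse_fourier h x) \<le>
    2 ^ N * measure lborel (cball (0 :: real ^ 'n) r) * A * decay_weight (real N / CARD('n)) x"
proof -
  let ?V = "measure lborel (cball (0 :: real ^ 'n) r)"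
  let ?a = "norm (inverse_fourier h x)"
  define K where "K = 2 ^ N * ?V * A"
  have K: "K \<ge> 0" using A by (simp add: K_def)
  (* for small x_i the trivial bound is used, otherwise N-fold integration by parts *)
  have each: "?a \<le> K * (1 + \<bar>x $ i\<bar>) powr (- real N)" for i
  proof -
    obtain D where D: "partial_derivative_chain i N UNIV D" "D 0 = h"
        "\<And>k x. k \<le> N \<Longrightarrow> r < norm x \<Longrightarrow> D k x = 0" "\<And>k x. k \<le> N \<Longrightarrow> norm (D k x) \<le> A"
      using smooth[of i] by blast
    have le: "norm (inverse_fourier (D k) x) \<le> A * ?V" if "k \<le> N" for k
      using D that by (intro norm_inverse_fourier_le) (auto simp: partial_derivative_chain_def)
    have "(2 * pi * \<bar>x $ i\<bar>) ^ N * ?a = norm (inverse_fourier (D N) x)"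
      using inverse_fourier_chain[OF D(1,3), where k=N and x=x]
      by (simp add: D(2) norm_mult norm_power)
    with le[of N] have 1: "(2 * pi * \<bar>x $ i\<bar>) ^ N * ?a \<le> A * ?V"
      by simp
    have 2: "?a \<le> A * ?V"
      using le[of 0] D(2) by simp
    have "(1 + \<bar>x $ i\<bar>) ^ N * ?a \<le> 2 ^ N * (A * ?V)"
    proof (cases "\<bar>x $ i\<bar> \<le> 1")
      case True
      then have "(1 + \<bar>x $ i\<bar>) ^ N \<le> 2 ^ N"
        by (intro power_mono) auto
      with 2 show ?thesis
        by (intro mult_mono) auto
    next
      case False
      have "1 * \<bar>x $ i\<bar> \<le> pi * \<bar>x $ i\<bar>"
        using pi_ge_two by (intro mult_right_mono) auto
      then have "1 + \<bar>x $ i\<bar> \<le> 2 * (2 * pi * \<bar>x $ i\<bar>)"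
        using False by linarith
      then have "(1 + \<bar>x $ i\<bar>) ^ N \<le> (2 * (2 * pi * \<bar>x $ i\<bar>)) ^ N"
        by (intro power_mono) auto
      then have "(1 + \<bar>x $ i\<bar>) ^ N * ?a \<le> (2 * (2 * pi * \<bar>x $ i\<bar>)) ^ N * ?a"
        by (rule mult_right_mono) simp
      also have "\<dots> = 2 ^ N * ((2 * pi * \<bar>x $ i\<bar>) ^ N * ?a)"
        by (subst power_mult_distrib) (rule mult.assoc)
      also have "\<dots> \<le> 2 ^ N * (A * ?V)"
        using 1 by simp
      finally show ?thesis .
    qed
    then show ?thesis
      by (simp add: K_def powr_minus powr_realpow field_simps)
  qed
  have "?a \<le> K * decay_weight (real N / CARD('n)) x"
  proof (cases "?a = 0")
    case True
    then show ?thesis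
      using K by (simp add: decay_weight_nonneg)
  next
    case False
    let ?n = "real CARD('n)"
    have root: "(y powr (1 / ?n)) ^ CARD('n) = y" if "y \<ge> 0" for y :: real
    proof (cases "y = 0")
      case False
      with that have "(y powr (1 / ?n)) ^ CARD('n) = (y powr (1 / ?n)) powr ?n"
        by (subst powr_realpow) auto
      also have "\<dots> = y"
        using that False by (simp add: powr_powr)
      finally show ?thesis .
    qed simp
    have "?a = (\<Prod>i\<in>(UNIV :: 'n set). ?a powr (1 / ?n))"
      by (simp add: root)
    also have "\<dots> \<le> (\<Prod>i\<in>UNIV. (K * (1 + \<bar>x $ i\<bar>) powr (- real N)) powr (1 / ?n))"
      by (intro prod_mono conjI powr_mono2 each) auto
    also have "\<dots> = (\<Prod>i\<in>(UNIV::'n set). K powr (1 / ?n)) * decay_weight (real N / ?n) x"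
      using K by (simp add: powr_mult powr_powr decay_weight_def prod.distrib)
    also have "(\<Prod>i\<in>(UNIV::'n set). K powr (1 / ?n)) = K"
      using K by (simp add: root)
    finally show ?thesis .
  qed
  then show ?thesis by (simp add: K_def)
qed

section \<open>A smooth cutoff and the Leibniz rule\<close>

text \<open>Start from a piecewise linear cutoff and average it \<open>N\<close> times over short intervals. If \<open>\<theta>\<close> is
  the average of \<open>\<eta>\<close> over \<open>[t - e, t + e]\<close> then \<open>\<theta>'\<close> is the difference quotient
  \<open>(\<eta> (t + e) - \<eta> (t - e)) / (2 * e)\<close>, so each averaging gains one derivative and costs \<open>e\<close> on
  either side of the transition zone.\<close>
lemma smooth_cutoff_exists:
  fixes a b :: real
  assumes "0 < a" "a < b"
  shows "\<exists>\<eta> :: nat \<Rightarrow> real \<Rightarrow> real.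
      (\<forall>k\<le>N. continuous_on UNIV (\<eta> k)) \<and>
      (\<forall>k<N. \<forall>t. (\<eta> k has_real_derivative \<eta> (Suc k) t) (at t)) \<and>
      (\<forall>k\<le>N. \<forall>t. \<bar>t\<bar> \<le> a \<longrightarrow> \<eta> k t = (if k = 0 then 1 else 0)) \<and>
      (\<forall>k\<le>N. \<forall>t. b \<le> \<bar>t\<bar> \<longrightarrow> \<eta> k t = 0)"
  using assms
proof (induction N arbitrary: a b)
  case 0
  define \<eta> :: "nat \<Rightarrow> real \<Rightarrow> real" where "\<eta> k t = max 0 (min 1 ((b - \<bar>t\<bar>) / (b - a)))" for k t
  have "continuous_on UNIV (\<eta> 0)"
    unfolding \<eta>_def[abs_def] using 0 by (intro continuous_intros) auto
  moreover have "\<eta> 0 t = 1" if "\<bar>t\<bar> \<le> a" for t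
    using that 0 by (simp add: \<eta>_def min_def max_def divide_simps)
  moreover have "\<eta> 0 t = 0" if "b \<le> \<bar>t\<bar>" for t
    using that 0 by (simp add: \<eta>_def min_def max_def divide_simps)
  ultimately show ?case
    by (intro exI[of _ \<eta>]) auto
next
  case (Suc N)
  define e where "e = (b - a) / 3"
  have e: "e > 0" "0 < a + e" "a + e < b - e"
    using Suc.prems by (auto simp: e_def field_simps)
  obtain \<eta> :: "nat \<Rightarrow> real \<Rightarrow> real" where
      \<eta>: "\<forall>k\<le>N. continuous_on UNIV (\<eta> k)"
        "\<forall>k<N. \<forall>t. (\<eta> k has_real_derivative \<eta> (Suc k) t) (at t)"
        "\<forall>k\<le>N. \<forall>t. \<bar>t\<bar> \<le> a + e \<longrightarrow> \<eta> k t = (if k = 0 then 1 else 0)"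
        "\<forall>k\<le>N. \<forall>t. b - e \<le> \<bar>t\<bar> \<longrightarrow> \<eta> k t = 0"
    using Suc.IH[OF e(2,3)] by blast
  note cont = \<eta>(1)[rule_format] and der = \<eta>(2)[rule_format]
    and inner = \<eta>(3)[rule_format] and outer = \<eta>(4)[rule_format]
  (* averages are written as differences of an antiderivative, so that they can be differentiated *)
  obtain F where F: "\<And>t. (F has_real_derivative \<eta> 0 t) (at t)"
  proof -
    have "isCont (\<eta> 0) t" for t
      using cont[of 0] by (simp add: continuous_on_eq_continuous_at)
    then have "\<exists>F. \<forall>t. (F has_vector_derivative \<eta> 0 t) (at t)"
      using einterval_antiderivative[of "-\<infinity>" "\<infinity>" "\<eta> 0"] by auto
    then show ?thesis
      using that by (auto simp: has_real_derivative_iff_has_vector_derivative)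
  qed
  define \<theta> where "\<theta> k t = (case k of 0 \<Rightarrow> (F (t + e) - F (t - e)) / (2 * e)
      | Suc k \<Rightarrow> (\<eta> k (t + e) - \<eta> k (t - e)) / (2 * e))" for k t
  (* an average is a value at an intermediate point: this transfers the plateau and the support *)
  have mean: "\<exists>z. \<bar>z - t\<bar> < e \<and> \<theta> 0 t = \<eta> 0 z" for t
  proof -
    obtain z where z: "t - e < z" "z < t + e" "F (t + e) - F (t - e) = (t + e - (t - e)) * \<eta> 0 z"
      using MVT2[of "t - e" "t + e" F "\<eta> 0"] F e(1) by auto
    moreover have "\<theta> 0 t = \<eta> 0 z"
      using z(3) e(1) by (simp add: \<theta>_def)
    ultimately show ?thesis
      by (intro exI[of _ z]) auto
  qed
  have der': "(\<theta> k has_real_derivative \<theta> (Suc k) t) (at t)" if "k \<le> N" for k t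
  proof (cases k)
    case 0
    show ?thesis
      unfolding 0 \<theta>_def nat.case using e(1)
      by (auto intro!: derivative_eq_intros DERIV_chain2[OF F] simp: field_simps)
  next
    case (Suc l)
    with that have "l < N" by simp
    show ?thesis
      unfolding Suc \<theta>_def nat.case using e(1)
      by (auto intro!: derivative_eq_intros DERIV_chain2[OF der[OF \<open>l < N\<close>]] simp: field_simps)
  qed
  have cont': "continuous_on UNIV (\<theta> k)" if "k \<le> Suc N" for k
  proof (cases k)
    case 0
    show ?thesis
      unfolding 0 using der'[of 0] by (intro DERIV_continuous_on) (auto intro: DERIV_subset)
  next
    case (Suc l)
    with that have "continuous_on UNIV (\<eta> l)" by (intro cont) auto
    then have c: "continuous_on UNIV (\<lambda>t. \<eta> l (t + c))" for c
      by (rule continuous_on_compose2) (auto intro: continuous_intros)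
    show ?thesis
      unfolding Suc \<theta>_def nat.case using e(1) c[of e] c[of "- e"] by (intro continuous_intros) auto
  qed
  have inner': "\<theta> k t = (if k = 0 then 1 else 0)" if "k \<le> Suc N" "\<bar>t\<bar> \<le> a" for k t
  proof (cases k)
    case 0
    obtain z where "\<bar>z - t\<bar> < e" "\<theta> 0 t = \<eta> 0 z" using mean by blast
    then show ?thesis using inner[of 0 z] that 0 by auto
  next
    case (Suc l)
    then show ?thesis
      using inner[of l "t + e"] inner[of l "t - e"] that e by (auto simp: \<theta>_def)
  qed
  have outer': "\<theta> k t = 0" if "k \<le> Suc N" "b \<le> \<bar>t\<bar>" for k t
  proof (cases k)
    case 0
    obtain z where "\<bar>z - t\<bar> < e" "\<theta> 0 t = \<eta> 0 z" using mean by blast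
    then show ?thesis using outer[of 0 z] that 0 by auto
  next
    case (Suc l)
    then show ?thesis
      using outer[of l "t + e"] outer[of l "t - e"] that e by (auto simp: \<theta>_def)
  qed
  show ?case
  proof (intro exI[of _ \<theta>] conjI allI impI)
    show "(\<theta> k has_real_derivative \<theta> (Suc k) t) (at t)" if "k < Suc N" for k t
      using that by (intro der') simp
  qed (fact cont' inner' outer')+
qed

text \<open>Pascal's rule in the form in which it advances Leibniz' formula from order \<open>k\<close> to \<open>Suc k\<close>.\<close>
lemma leibniz_step:
  fixes P Q :: "nat \<Rightarrow> 'a::comm_ring_1"
  shows "(\<Sum>l\<le>k. of_nat (k choose l) * (P l * Q (Suc (k - l)) + P (Suc l) * Q (k - l)))
    = (\<Sum>l\<le>Suc k. of_nat (Suc k choose l) * (P l * Q (Suc k - l)))"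
proof -
  have "(\<Sum>l\<le>Suc k. of_nat (Suc k choose l) * (P l * Q (Suc k - l)))
      = P 0 * Q (Suc k) + (\<Sum>l\<le>k. of_nat (k choose Suc l) * (P (Suc l) * Q (k - l)))
        + (\<Sum>l\<le>k. of_nat (k choose l) * (P (Suc l) * Q (k - l)))"
    by (subst sum.atMost_Suc_shift) (simp add: algebra_simps sum.distrib)
  also have "P 0 * Q (Suc k) + (\<Sum>l\<le>k. of_nat (k choose Suc l) * (P (Suc l) * Q (k - l)))
      = (\<Sum>l\<le>Suc k. of_nat (k choose l) * (P l * Q (Suc k - l)))"
    by (subst sum.atMost_Suc_shift) simp
  also have "\<dots> = (\<Sum>l\<le>k. of_nat (k choose l) * (P l * Q (Suc (k - l))))"
    by (simp add: Suc_diff_le binomial_eq_0)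
  finally show ?thesis
    by (simp add: algebra_simps sum.distrib)
qed

definition leibniz :: "(nat \<Rightarrow> 'b \<Rightarrow> complex) \<Rightarrow> (nat \<Rightarrow> 'b \<Rightarrow> complex) \<Rightarrow> nat \<Rightarrow> 'b \<Rightarrow> complex" where
  "leibniz P Q k x = (\<Sum>l\<le>k. of_nat (k choose l) * (P l x * Q (k - l) x))"

lemma partial_derivative_chain_mult:
  assumes P: "partial_derivative_chain i N S P" and Q: "partial_derivative_chain i N S Q"
  shows "partial_derivative_chain i N S (leibniz P Q)"
  unfolding partial_derivative_chain_def
proof (intro conjI allI impI ballI)
  fix k assume "k \<le> N"
  then show "continuous_on S (leibniz P Q k)"
    unfolding leibniz_def[abs_def] using P Q
    by (intro continuous_intros) (auto simp: partial_derivative_chain_def)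
next
  fix k x assume k: "k < N" and x: "x \<in> S"
  have "has_partial_derivative i (leibniz P Q k)
      (\<Sum>l\<le>k. of_nat (k choose l) * (P l x * Q (Suc (k - l)) x + P (Suc l) x * Q (k - l) x)) x"
    unfolding leibniz_def
  proof (intro has_vector_derivative_sum has_vector_derivative_mult_right)
    fix l assume "l \<in> {..k}"
    then have "has_partial_derivative i (P l) (P (Suc l) x) x"
        "has_partial_derivative i (Q (k - l)) (Q (Suc (k - l)) x) x"
      using P Q k x by (auto simp: partial_derivative_chain_def)
    from has_vector_derivative_mult[OF this]
    show "((\<lambda>t. P l (x + t *\<^sub>R axis i 1) * Q (k - l) (x + t *\<^sub>R axis i 1)) has_vector_derivative
        P l x * Q (Suc (k - l)) x + P (Suc l) x * Q (k - l) x) (at 0)"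
      by simp
  qed
  then show "has_partial_derivative i (leibniz P Q k) (leibniz P Q (Suc k) x) x"
    unfolding leibniz_step[of k "\<lambda>l. P l x" "\<lambda>l. Q l x"] unfolding leibniz_def .
qed

lemma norm_leibniz_le:
  assumes A: "\<And>l. l \<le> k \<Longrightarrow> norm (P l x) \<le> A" and B: "\<And>l. l \<le> k \<Longrightarrow> norm (Q l x) \<le> B"
  shows "norm (leibniz P Q k x) \<le> 2 ^ k * (A * B)"
proof -
  have "A \<ge> 0" using A[of 0] norm_ge_zero order_trans by blast
  have "norm (leibniz P Q k x) \<le> (\<Sum>l\<le>k. real (k choose l) * (A * B))"
    unfolding leibniz_def using A B \<open>A \<ge> 0\<close>
    by (intro sum_norm_le) (auto simp: norm_mult intro!: mult_left_mono mult_mono)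
  also have "\<dots> = real (\<Sum>l\<le>k. k choose l) * (A * B)"
    by (simp add: sum_distrib_right)
  finally show ?thesis
    by (simp add: choose_row_sum)
qed

text \<open>The symbol need not be differentiable at the origin; after multiplication with a cutoff vanishing
  near the origin this singularity disappears.\<close>
lemma partial_derivative_chain_extend_0:
  fixes D :: "nat \<Rightarrow> real ^ 'n::finite \<Rightarrow> complex"
  assumes D: "partial_derivative_chain i N (UNIV - {0}) D" and r: "r > 0"
    and zero: "\<And>k x. k \<le> N \<Longrightarrow> norm x < r \<Longrightarrow> D k x = 0"
  shows "partial_derivative_chain i N UNIV D"
  unfolding partial_derivative_chain_def
proof (intro conjI allI impI ballI)
  fix k assume k: "k \<le> N"
  have "continuous_on (ball 0 r \<union> (UNIV - {0})) (D k)"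
  proof (rule continuous_on_open_Un)
    have "continuous_on (ball 0 r) (D k) \<longleftrightarrow> continuous_on (ball 0 r) (\<lambda>_::real ^ 'n. 0 :: complex)"
      by (rule continuous_on_cong) (auto simp: zero k)
    then show "continuous_on (ball 0 r) (D k)" by simp
    show "continuous_on (UNIV - {0}) (D k)"
      using D k by (auto simp: partial_derivative_chain_def)
  qed auto
  also have "ball 0 r \<union> (UNIV - {0}) = (UNIV :: (real ^ 'n) set)"
    using r by auto
  finally show "continuous_on UNIV (D k)" .
next
  fix k and x :: "real ^ 'n" assume k: "k < N"
  show "has_partial_derivative i (D k) (D (Suc k) x) x"
  proof (cases "x = 0")
    case False
    then show ?thesis using D k by (auto simp: partial_derivative_chain_def)
  next
    case True
    have "((\<lambda>t::real. 0) has_vector_derivative (0::complex)) (at 0)"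
      by simp
    then have "((\<lambda>t. D k (0 + t *\<^sub>R axis i 1)) has_vector_derivative 0) (at 0)"
    proof (rule has_vector_derivative_transform_within_open)
      show "0 = D k (0 + t *\<^sub>R axis i 1)" if "t \<in> ball 0 r" for t
        using that k by (simp add: zero)
    qed (use r in auto)
    then show ?thesis
      using True zero[of "Suc k" 0] k r by simp
  qed
qed


lemma partial_derivative_chain_scale:
  assumes D: "partial_derivative_chain i N S D" and S': "\<And>x. x \<in> S' \<Longrightarrow> c *\<^sub>R x \<in> S"
  shows "partial_derivative_chain i N S' (\<lambda>k x. of_real c ^ k * D k (c *\<^sub>R x))"
  unfolding partial_derivative_chain_def
proof (intro conjI allI impI ballI)
  fix k assume "k \<le> N"
  with D have "continuous_on S (D k)" by (simp add: partial_derivative_chain_def)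
  then have "continuous_on S' (\<lambda>x. D k (c *\<^sub>R x))"
    by (rule continuous_on_compose2) (use S' in \<open>auto intro!: continuous_intros\<close>)
  then show "continuous_on S' (\<lambda>x. of_real c ^ k * D k (c *\<^sub>R x))"
    by (intro continuous_intros)
next
  fix k x assume "k < N" "x \<in> S'"
  with D S' have d: "has_partial_derivative i (D k) (D (Suc k) (c *\<^sub>R x)) (c *\<^sub>R x)"
    by (simp add: partial_derivative_chain_def)
  have "(((\<lambda>t. D k (c *\<^sub>R x + t *\<^sub>R axis i 1)) \<circ> (\<lambda>t. c * t)) has_vector_derivative
      c *\<^sub>R D (Suc k) (c *\<^sub>R x)) (at 0)"
  proof (rule vector_diff_chain_at)
    show "((\<lambda>t. c * t) has_vector_derivative c) (at 0)"
      by (auto intro!: derivative_eq_intros simp flip: has_real_derivative_iff_has_vector_derivative)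
  qed (use d in simp)
  from has_vector_derivative_mult_right[OF this, of "of_real c ^ k"]
  have "((\<lambda>t. of_real c ^ k * D k (c *\<^sub>R x + (c * t) *\<^sub>R axis i 1)) has_vector_derivative
      of_real c ^ k * (c *\<^sub>R D (Suc k) (c *\<^sub>R x))) (at 0)"
    by (simp only: o_def)
  moreover have "c *\<^sub>R x + (c * t) *\<^sub>R axis i 1 = c *\<^sub>R (x + t *\<^sub>R axis i 1)" for t
    by (simp add: scaleR_add_right)
  moreover have "of_real c ^ k * (c *\<^sub>R D (Suc k) (c *\<^sub>R x)) = of_real c ^ Suc k * D (Suc k) (c *\<^sub>R x)"
    by (simp add: scaleR_conv_of_real[where 'a=complex])
  ultimately show "has_partial_derivative i (\<lambda>x. of_real c ^ k * D k (c *\<^sub>R x))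
      (of_real c ^ Suc k * D (Suc k) (c *\<^sub>R x)) x"
    by (simp only:)
qed

lemma partial_derivative_chain_diff:
  assumes "partial_derivative_chain i N S D" "partial_derivative_chain i N S E"
  shows "partial_derivative_chain i N S (\<lambda>k x. D k x - E k x)"
  using assms unfolding partial_derivative_chain_def
  by (auto intro!: continuous_intros has_vector_derivative_diff)

section \<open>A partition of space into dyadic annuli\<close>

lemma partial_derivative_chain_tensor:
  fixes \<eta> :: "nat \<Rightarrow> real \<Rightarrow> real" and i :: "'n::finite"
  assumes cont: "\<And>k. k \<le> N \<Longrightarrow> continuous_on UNIV (\<eta> k)"
    and der: "\<And>k t. k < N \<Longrightarrow> (\<eta> k has_real_derivative \<eta> (Suc k) t) (at t)"
  shows "partial_derivative_chain i N UNIV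
    (\<lambda>k x. of_real (\<eta> k (x $ i) * (\<Prod>j\<in>UNIV - {i}. \<eta> 0 (x $ j))))"
  unfolding partial_derivative_chain_def
proof (intro conjI allI impI ballI)
  fix k assume k: "k \<le> N"
  have c: "continuous_on UNIV (\<lambda>x::real ^ 'n. \<eta> l (x $ j))" if "l \<le> N" for l j
    by (rule continuous_on_compose2[OF cont[OF that]]) (auto intro!: continuous_intros)
  show "continuous_on UNIV (\<lambda>x::real ^ 'n. complex_of_real (\<eta> k (x $ i) * (\<Prod>j\<in>UNIV - {i}. \<eta> 0 (x $ j))))"
    by (intro continuous_intros c k) auto
next
  fix k and x :: "real ^ 'n" assume k: "k < N"
  have "((\<lambda>t. \<eta> k (x $ i + t)) has_real_derivative \<eta> (Suc k) (x $ i)) (at 0)"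
    using DERIV_shift[of "\<eta> k" "\<eta> (Suc k) (x $ i)" 0 "x $ i"] der[OF k, of "x $ i"] by (simp add: add.commute)
  then have "((\<lambda>t. \<eta> k (x $ i + t) * (\<Prod>j\<in>UNIV - {i}. \<eta> 0 (x $ j))) has_real_derivative
      \<eta> (Suc k) (x $ i) * (\<Prod>j\<in>UNIV - {i}. \<eta> 0 (x $ j))) (at 0)"
    by (rule DERIV_cmult_right)
  then have "((\<lambda>t. of_real (\<eta> k (x $ i + t) * (\<Prod>j\<in>UNIV - {i}. \<eta> 0 (x $ j))) :: complex) has_vector_derivative
      of_real (\<eta> (Suc k) (x $ i) * (\<Prod>j\<in>UNIV - {i}. \<eta> 0 (x $ j)))) (at 0)"
    by (intro has_vector_derivative_of_real) (simp add: has_real_derivative_iff_has_vector_derivative)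
  moreover have "(\<Prod>j\<in>UNIV - {i}. \<eta> 0 ((x + t *\<^sub>R axis i 1) $ j)) = (\<Prod>j\<in>UNIV - {i}. \<eta> 0 (x $ j))" for t
    by (intro prod.cong) (auto simp: axis_def)
  moreover have "(x + t *\<^sub>R axis i 1) $ i = x $ i + t" for t
    by simp
  ultimately show "has_partial_derivative i
      (\<lambda>x. of_real (\<eta> k (x $ i) * (\<Prod>j\<in>UNIV - {i}. \<eta> 0 (x $ j))))
      (of_real (\<eta> (Suc k) (x $ i) * (\<Prod>j\<in>UNIV - {i}. \<eta> 0 (x $ j)))) x"
    by simp
qed

lemma large_coordinate:
  fixes x :: "real ^ 'n::finite"
  assumes "real CARD('n) * r \<le> norm x"
  obtains j where "r \<le> \<bar>x $ j\<bar>"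
proof (rule ccontr)
  assume "\<not> thesis"
  with that have "\<bar>x $ j\<bar> < r" for j
    by (meson not_le)
  then have "(\<Sum>j\<in>UNIV. \<bar>x $ j\<bar>) < (\<Sum>j\<in>(UNIV :: 'n set). r)"
    by (intro sum_strict_mono) auto
  with norm_le_l1_cart[of x] assms show False by simp
qed

text \<open>\<open>X\<close> is a tensor product of one-dimensional cutoffs, so that a pure derivative in direction \<open>i\<close>
  hits a single factor. \<open>Q i\<close> is the sequence of derivatives in direction \<open>i\<close> of
  \<open>X x - X (2 *\<^sub>R x)\<close>, which lives on an annulus: near the origin both terms are \<open>1\<close>, far out both
  are \<open>0\<close>. The radius \<open>2 * CARD('n)\<close> comes from comparing the Euclidean norm with the largest
  coordinate.\<close>
lemma annulus_cutoff_exists: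
  obtains X :: "real ^ 'n::finite \<Rightarrow> complex" and Q :: "'n \<Rightarrow> nat \<Rightarrow> real ^ 'n \<Rightarrow> complex" and B :: real
  where "\<And>x. norm x \<le> 1 \<Longrightarrow> X x = 1" "\<And>x. 2 * real CARD('n) \<le> norm x \<Longrightarrow> X x = 0"
    "\<And>i. partial_derivative_chain i N UNIV (Q i)" "\<And>i x. Q i 0 x = X x - X (2 *\<^sub>R x)"
    "\<And>i k x. k \<le> N \<Longrightarrow> norm (Q i k x) \<le> B"
    "\<And>i k x. k \<le> N \<Longrightarrow> norm x \<le> 1 / 2 \<Longrightarrow> Q i k x = 0"
    "\<And>i k x. k \<le> N \<Longrightarrow> 2 * real CARD('n) \<le> norm x \<Longrightarrow> Q i k x = 0"
proof -
  obtain \<eta> :: "nat \<Rightarrow> real \<Rightarrow> real" where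
      \<eta>: "\<forall>k\<le>N. continuous_on UNIV (\<eta> k)"
        "\<forall>k<N. \<forall>t. (\<eta> k has_real_derivative \<eta> (Suc k) t) (at t)"
        "\<forall>k\<le>N. \<forall>t. \<bar>t\<bar> \<le> 1 \<longrightarrow> \<eta> k t = (if k = 0 then 1 else 0)"
        "\<forall>k\<le>N. \<forall>t. 2 \<le> \<bar>t\<bar> \<longrightarrow> \<eta> k t = 0"
  proof -
    have "(1::real) < 2" by simp
    from smooth_cutoff_exists[OF zero_less_one this, of N] show ?thesis
      using that by blast
  qed
  note cont = \<eta>(1)[rule_format] and der = \<eta>(2)[rule_format]
    and inner = \<eta>(3)[rule_format] and outer = \<eta>(4)[rule_format]
  define T :: "'n \<Rightarrow> nat \<Rightarrow> real ^ 'n \<Rightarrow> complex"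
    where "T i k x = of_real (\<eta> k (x $ i) * (\<Prod>j\<in>UNIV - {i}. \<eta> 0 (x $ j)))" for i k x
  define X :: "real ^ 'n \<Rightarrow> complex" where "X x = of_real (\<Prod>j\<in>UNIV. \<eta> 0 (x $ j))" for x
  define Q where "Q i k x = T i k x - of_real 2 ^ k * T i k (2 *\<^sub>R x)" for i k x
  have T0: "T i 0 x = X x" for i x
    by (simp add: T_def X_def prod.remove[of UNIV i])
  have T_chain: "partial_derivative_chain i N UNIV (T i)" for i
    unfolding T_def[abs_def] by (rule partial_derivative_chain_tensor) (fact cont der)+
  have T_inner: "T i k x = (if k = 0 then 1 else 0)" if "k \<le> N" "norm x \<le> 1" for i k x
  proof -
    have "\<bar>x $ j\<bar> \<le> 1" for j
      using component_le_norm_cart[of x j] that by linarith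
    then show ?thesis
      using that by (simp add: T_def inner)
  qed
  have T_outer: "T i k x = 0" if k: "k \<le> N" and x: "2 * real CARD('n) \<le> norm x" for i k x
  proof -
    obtain j where "2 \<le> \<bar>x $ j\<bar>"
      using large_coordinate[of 2 x] x by (auto simp: mult.commute)
    then have "\<eta> l (x $ j) = 0" if "l \<le> N" for l
      using outer that by simp
    then show ?thesis
      using k by (cases "j = i") (auto simp: T_def intro!: prod_zero)
  qed
  have "\<exists>M. \<forall>k\<le>N. \<forall>t. \<bar>\<eta> k t\<bar> \<le> M"
  proof -
    have "\<exists>M. \<forall>t. \<bar>\<eta> k t\<bar> \<le> M" if "k \<le> N" for k
    proof -
      have "continuous_on UNIV (\<lambda>t. complex_of_real (\<eta> k t))"
        by (intro continuous_intros cont that)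
      moreover have "complex_of_real (\<eta> k t) = 0" if "2 < norm t" for t
        using outer[OF \<open>k \<le> N\<close>, of t] that by simp
      ultimately obtain M where "\<And>t. norm (complex_of_real (\<eta> k t)) \<le> M"
        using bounded_compact_support by blast
      then show ?thesis by auto
    qed
    then obtain M where M: "\<And>k t. k \<le> N \<Longrightarrow> \<bar>\<eta> k t\<bar> \<le> M k"
      by metis
    have "\<bar>\<eta> k t\<bar> \<le> (\<Sum>k\<le>N. \<bar>M k\<bar>)" if "k \<le> N" for k t
    proof -
      have "\<bar>\<eta> k t\<bar> \<le> \<bar>M k\<bar>" using M[OF that, of t] by linarith
      also have "\<dots> \<le> (\<Sum>k\<le>N. \<bar>M k\<bar>)" using that by (intro member_le_sum) auto
      finally show ?thesis .
    qed
    then show ?thesis by blast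
  qed
  then obtain M where M: "\<And>k t. k \<le> N \<Longrightarrow> \<bar>\<eta> k t\<bar> \<le> M" by blast
  have T_bound: "norm (T i k x) \<le> M * M ^ (CARD('n) - 1)" if "k \<le> N" for i k x
  proof -
    have "0 \<le> M" using M[of 0 0] by simp
    have "\<bar>\<eta> k (x $ i)\<bar> * (\<Prod>j\<in>UNIV - {i}. \<bar>\<eta> 0 (x $ j)\<bar>) \<le> M * (\<Prod>j\<in>UNIV - {i}. M)"
      using that \<open>0 \<le> M\<close> by (intro mult_mono prod_mono conjI M prod_nonneg) auto
    also have "(\<Prod>j\<in>UNIV - {i}. M) = M ^ (CARD('n) - 1)"
      by (simp add: card_Diff_singleton)
    finally show ?thesis
      by (simp add: T_def abs_mult abs_prod norm_mult del: of_real_mult)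
  qed
  show ?thesis
  proof (rule that[of X Q "(1 + 2 ^ N) * (M * M ^ (CARD('n) - 1))"])
    show "X x = 1" if "norm x \<le> 1" for x
      using T_inner[of 0 x] T0 that by simp
    show "X x = 0" if "2 * real CARD('n) \<le> norm x" for x
      using T_outer[of 0 x] T0 that by simp
    show "partial_derivative_chain i N UNIV (Q i)" for i
      unfolding Q_def[abs_def]
      by (intro partial_derivative_chain_diff partial_derivative_chain_scale[OF T_chain] T_chain) auto
    show "Q i 0 x = X x - X (2 *\<^sub>R x)" for i x
      by (simp add: Q_def T0)
    show "norm (Q i k x) \<le> (1 + 2 ^ N) * (M * M ^ (CARD('n) - 1))" if k: "k \<le> N" for i k x
    proof -
      let ?C = "M * M ^ (CARD('n) - 1)"
      have "norm (Q i k x) \<le> norm (T i k x) + 2 ^ k * norm (T i k (2 *\<^sub>R x))"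
        unfolding Q_def by (rule order_trans[OF norm_triangle_ineq4]) (simp add: norm_mult norm_power)
      also have "\<dots> \<le> ?C + 2 ^ N * ?C"
        using k by (intro add_mono mult_mono T_bound power_increasing) auto
      finally show ?thesis by (simp add: algebra_simps)
    qed
    show "Q i k x = 0" if "k \<le> N" "norm x \<le> 1 / 2" for i k x
      using T_inner[of k x i] T_inner[of k "2 *\<^sub>R x" i] that by (simp add: Q_def)
    show "Q i k x = 0" if "k \<le> N" "2 * real CARD('n) \<le> norm x" for i k x
      using T_outer[of k x i] T_outer[of k "2 *\<^sub>R x" i] that by (simp add: Q_def)
  qed
qed

section \<open>The dyadic pieces of the symbol\<close>

lemma Ck_on_imp_partial_derivative_chain:
  assumes "Ck_on N S f"
  shows "partial_derivative_chain i N S (\<lambda>k. (partial i ^^ k) f)"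
  using assms
proof (induction N arbitrary: f)
  case 0
  then show ?case by (simp add: partial_derivative_chain_def)
next
  case (Suc N)
  then have "partial_derivative_chain i N S (\<lambda>k. (partial i ^^ k) (partial i f))"
    by simp
  then have IH: "partial_derivative_chain i N S (\<lambda>k. (partial i ^^ Suc k) f)"
    by (simp add: funpow_swap1)
  have first: "has_partial_derivative i f (partial i f x) x" if "x \<in> S" for x
    using Suc.prems that unfolding partial_def by (auto simp: has_partial_def vector_derivative_works)
  have "continuous_on S f"
    using Suc.prems by simp
  show ?case
    unfolding partial_derivative_chain_def
  proof (intro conjI allI impI ballI)
    fix k assume "k \<le> Suc N"
    then show "continuous_on S ((partial i ^^ k) f)"
      using IH \<open>continuous_on S f\<close> by (cases k) (auto simp: partial_derivative_chain_def)
  next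
    fix k x assume "k < Suc N" "x \<in> S"
    then show "has_partial_derivative i ((partial i ^^ k) f) ((partial i ^^ Suc k) f x) x"
      using IH first by (cases k) (auto simp: partial_derivative_chain_def)
  qed
qed

text \<open>The factors in the other directions have order \<open>0\<close>, hence are identities.\<close>
lemma partials_single:
  "partials (\<lambda>j. if j = i then k else 0) f = (partial i ^^ k) f"
proof -
  have "\<exists>is :: 'a list. distinct is \<and> set is = UNIV"
    using finite_distinct_list[of "UNIV :: 'a set"] by auto
  then have c: "distinct (coords :: 'a list) \<and> set (coords :: 'a list) = UNIV"
    unfolding coords_def by (rule someI_ex)
  have "foldr (\<lambda>j. partial j ^^ (if j = i then k else 0)) is f =
      (if i \<in> set is then (partial i ^^ k) f else f)" if "distinct is" for "is"
    using that by (induction "is") auto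
  with c show ?thesis
    by (simp add: partials_def)
qed

lemma one_plus_abs_ln_le:
  fixes r e :: real
  assumes "0 < r" "r \<le> 1" "0 < e"
  shows "1 + \<bar>ln r\<bar> \<le> (1 + 1 / e) * r powr (- e)"
proof -
  have "- e * ln r = ln (r powr (- e))"
    using assms by (simp add: ln_powr)
  also have "\<dots> \<le> r powr (- e) - 1"
    using assms by (intro ln_le_minus_one) simp
  finally have "- e * ln r \<le> r powr (- e)" by simp
  then have "- ln r \<le> r powr (- e) / e"
    using assms by (simp add: field_simps)
  moreover have "\<bar>ln r\<bar> = - ln r"
    using assms by simp
  moreover have "1 \<le> r powr (- e)"
    using powr_mono'[of "- e" 0 r] assms by simp
  ultimately show ?thesis
    by (simp add: algebra_simps)
qed

text \<open>The two hypotheses merge into one estimate valid for all \<open>\<xi> \<noteq> 0\<close>: half of the exponent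
  \<open>\<delta>2\<close> absorbs the logarithm, and the smaller of \<open>\<delta>1\<close> and \<open>\<delta>2 / 2\<close> serves on both sides of the
  unit sphere.\<close>
lemma pure_derivative_bound:
  fixes f :: "real ^ 'n::finite \<Rightarrow> complex"
  assumes pos: "C > 0" "\<delta>1 > 0" "\<delta>2 > 0"
    and large: "\<And>\<alpha> \<xi>. order_of \<alpha> \<le> N \<Longrightarrow> norm \<xi> \<ge> 1 \<Longrightarrow>
           norm (partials \<alpha> f \<xi>) \<le> C * norm \<xi> powr (- \<delta>1 - real (order_of \<alpha>))"
    and small: "\<And>\<alpha> \<xi>. order_of \<alpha> \<le> N \<Longrightarrow> 0 < norm \<xi> \<Longrightarrow> norm \<xi> \<le> 2 \<Longrightarrow>
           norm (partials \<alpha> f \<xi>)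
             \<le> C * norm \<xi> powr (\<delta>2 - real (order_of \<alpha>)) * (1 + \<bar>ln (norm \<xi>)\<bar>)"
  obtains A \<delta> where "A \<ge> 0" "\<delta> > 0"
    "\<And>i k \<xi>. k \<le> N \<Longrightarrow> \<xi> \<noteq> 0 \<Longrightarrow> norm ((partial i ^^ k) f \<xi>)
        \<le> A * norm \<xi> powr (- real k) * min (norm \<xi> powr \<delta>) (norm \<xi> powr (- \<delta>))"
proof -
  define e where "e = \<delta>2 / 2"
  define \<delta> where "\<delta> = min \<delta>1 e"
  define A where "A = C * (1 + 1 / e)"
  have e: "e > 0" and \<delta>: "\<delta> > 0" "\<delta> \<le> \<delta>1" "\<delta> \<le> e" and A: "A \<ge> C"
    using pos by (auto simp: e_def \<delta>_def A_def)
  have "norm ((partial i ^^ k) f \<xi>) \<le> A * norm \<xi> powr (- real k) * min (norm \<xi> powr \<delta>) (norm \<xi> powr (- \<delta>))"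
    if k: "k \<le> N" and \<xi>: "\<xi> \<noteq> 0" for i k \<xi>
  proof -
    define \<alpha> where "\<alpha> = (\<lambda>j. if j = i then k else 0)"
    have \<alpha>: "order_of \<alpha> = k" "partials \<alpha> f = (partial i ^^ k) f"
      by (simp_all add: \<alpha>_def order_of_def partials_single)
    define r where "r = norm \<xi>"
    have r: "r > 0" using \<xi> by (simp add: r_def)
    show ?thesis
    proof (cases "r \<ge> 1")
      case True
      have "norm ((partial i ^^ k) f \<xi>) \<le> C * r powr (- \<delta>1 - real k)"
        using large[of \<alpha> \<xi>] k True by (simp add: \<alpha> r_def)
      also have "\<dots> = C * r powr (- real k) * r powr (- \<delta>1)"
        by (simp add: powr_add[symmetric] add.commute)
      also have "\<dots> \<le> A * r powr (- real k) * r powr (- \<delta>)"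
        using True \<delta> A pos by (intro mult_mono powr_mono) auto
      also have "r powr (- \<delta>) = min (r powr \<delta>) (r powr (- \<delta>))"
        using True \<delta> powr_mono[of "- \<delta>" \<delta> r] by simp
      finally show ?thesis unfolding r_def .
    next
      case False
      then have r1: "r \<le> 1" by simp
      have "norm ((partial i ^^ k) f \<xi>) \<le> C * r powr (\<delta>2 - real k) * (1 + \<bar>ln r\<bar>)"
        using small[of \<alpha> \<xi>] k r r1 by (simp add: \<alpha> r_def)
      also have "\<dots> \<le> C * r powr (\<delta>2 - real k) * ((1 + 1 / e) * r powr (- e))"
        using pos by (intro mult_left_mono one_plus_abs_ln_le r r1 e) auto
      also have "\<dots> = A * (r powr (\<delta>2 - real k) * r powr (- e))"
        by (simp add: A_def mult_ac)
      also have "r powr (\<delta>2 - real k) * r powr (- e) = r powr (- real k) * r powr e"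
        by (simp add: powr_add[symmetric] e_def)
      also have "A * (r powr (- real k) * r powr e) \<le> A * (r powr (- real k) * r powr \<delta>)"
        using r r1 \<delta> A pos by (intro mult_left_mono powr_mono') auto
      also have "r powr \<delta> = min (r powr \<delta>) (r powr (- \<delta>))"
        using r r1 \<delta> powr_mono'[of "- \<delta>" \<delta> r] by simp
      finally show ?thesis unfolding r_def by (simp add: mult.assoc)
    qed
  qed
  then show ?thesis
    using that[of A \<delta>] A \<delta> pos by (meson less_le_trans less_imp_le)
qed

lemma leibniz_eq_0: "(\<And>l. l \<le> k \<Longrightarrow> Q l x = 0) \<Longrightarrow> leibniz P Q k x = 0"
  by (simp add: leibniz_def)

text \<open>On the annulus carrying \<open>\<phi>\<close> the norm of \<open>x\<close> is comparable to \<open>1\<close>. The factor \<open>s ^ k\<close> produced by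
  differentiating \<open>f (s *\<^sub>R x)\<close> therefore cancels the homogeneous loss \<open>norm (s *\<^sub>R x) powr (- k)\<close>
  in the bound on \<open>f\<close>, and what remains is the gain \<open>min (s powr \<delta>) (s powr (- \<delta>))\<close>, uniformly in
  the order of differentiation.\<close>
lemma localised_pieces:
  fixes f :: "real ^ 'n::finite \<Rightarrow> complex"
  assumes Ck: "Ck_on N (UNIV - {0}) f"
    and A: "A \<ge> 0" "\<delta> > 0"
    and bound: "\<And>i k \<xi>. k \<le> N \<Longrightarrow> \<xi> \<noteq> 0 \<Longrightarrow> norm ((partial i ^^ k) f \<xi>)
        \<le> A * norm \<xi> powr (- real k) * min (norm \<xi> powr \<delta>) (norm \<xi> powr (- \<delta>))"
    and Q: "\<And>i. partial_derivative_chain i N UNIV (Q i)" "\<And>i. Q i 0 = \<phi>"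
    and QB: "\<And>i k x. k \<le> N \<Longrightarrow> norm (Q i k x) \<le> B"
    and Qin: "\<And>i k x. k \<le> N \<Longrightarrow> norm x \<le> 1 / 2 \<Longrightarrow> Q i k x = 0"
    and Qout: "\<And>i k x. k \<le> N \<Longrightarrow> 2 * real CARD('n) \<le> norm x \<Longrightarrow> Q i k x = 0"
    and s: "s > 0"
  shows "\<exists>D. partial_derivative_chain i N UNIV D \<and> D 0 = (\<lambda>x. f (s *\<^sub>R x) * \<phi> x) \<and>
      (\<forall>k\<le>N. \<forall>x. (2 * real CARD('n) < norm x \<longrightarrow> D k x = 0) \<and>
         norm (D k x) \<le> 2 ^ N * (A * 2 ^ N * (2 * real CARD('n)) powr \<delta> * B) * min (s powr \<delta>) (s powr (- \<delta>)))"
proof -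
  let ?n = "real CARD('n)"
  define m where "m = min (s powr \<delta>) (s powr (- \<delta>))"
  define P where "P k x = of_real s ^ k * (partial i ^^ k) f (s *\<^sub>R x)" for k x
  define A' where "A' = A * 2 ^ N * (2 * ?n) powr \<delta> * m"
  let ?D = "leibniz P (Q i)"
  have n: "?n \<ge> 1"
    by (simp add: Suc_leI)
  have m: "m \<ge> 0" by (simp add: m_def)
  have B: "B \<ge> 0" using QB[of 0 i 0] norm_ge_zero order_trans by blast
  have "partial_derivative_chain i N (UNIV - {0}) P"
    unfolding P_def[abs_def]
    by (rule partial_derivative_chain_scale[OF Ck_on_imp_partial_derivative_chain[OF Ck]]) (use s in auto)
  moreover have "partial_derivative_chain i N (UNIV - {0}) (Q i)"
    using Q(1)[of i] by (auto simp: partial_derivative_chain_def intro: continuous_on_subset)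
  ultimately have "partial_derivative_chain i N (UNIV - {0}) ?D"
    by (rule partial_derivative_chain_mult)
  then have chain: "partial_derivative_chain i N UNIV ?D"
  proof (rule partial_derivative_chain_extend_0[where r="1/2"])
    show "?D k x = 0" if "k \<le> N" "norm x < 1 / 2" for k x
      using that by (intro leibniz_eq_0 Qin) auto
  qed simp
  have P: "norm (P l x) \<le> A'" if l: "l \<le> N" and x: "1 / 2 \<le> norm x" "norm x \<le> 2 * ?n" for l x
  proof -
    let ?r = "norm x"
    have r: "?r > 0" using x by linarith
    have inv: "inverse ?r \<le> 2"
      using x le_imp_inverse_le[of "1/2" ?r] by simp
    then have inv': "inverse ?r \<le> 2 * ?n"
      using n by linarith
    have sr: "norm (s *\<^sub>R x) = s * ?r" using s by simp
    have "norm (P l x) = s ^ l * norm ((partial i ^^ l) f (s *\<^sub>R x))"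
      using s by (simp add: P_def norm_mult norm_power)
    also have "\<dots> \<le> s ^ l * (A * (s * ?r) powr (- real l) * min ((s * ?r) powr \<delta>) ((s * ?r) powr (- \<delta>)))"
      using bound[OF l, of "s *\<^sub>R x" i] s r unfolding sr by (intro mult_left_mono) auto
    also have "\<dots> = A * inverse ?r ^ l * min ((s * ?r) powr \<delta>) ((s * ?r) powr (- \<delta>))"
      using s r by (simp add: powr_minus powr_realpow power_mult_distrib field_simps)
    also have "\<dots> \<le> A * 2 ^ N * ((2 * ?n) powr \<delta> * m)"
    proof (intro mult_mono mult_left_mono)
      have "inverse ?r ^ l \<le> 2 ^ l"
        using r inv by (intro power_mono) auto
      also have "\<dots> \<le> 2 ^ N"
        using l by (intro power_increasing) auto
      finally show "inverse ?r ^ l \<le> 2 ^ N" .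
      have 1: "(s * ?r) powr \<delta> \<le> (2 * ?n) powr \<delta> * s powr \<delta>"
      proof -
        have "(s * ?r) powr \<delta> = ?r powr \<delta> * s powr \<delta>"
          by (metis powr_mult mult.commute)
        also have "\<dots> \<le> (2 * ?n) powr \<delta> * s powr \<delta>"
          using x A by (intro mult_right_mono powr_mono2) auto
        finally show ?thesis .
      qed
      have "?r powr (- \<delta>) = inverse ?r powr \<delta>"
        using r by (simp add: powr_minus inverse_powr)
      also have "\<dots> \<le> (2 * ?n) powr \<delta>"
        using inv' r A by (intro powr_mono2) auto
      finally have 2: "(s * ?r) powr (- \<delta>) \<le> (2 * ?n) powr \<delta> * s powr (- \<delta>)"
        using s r by (simp add: powr_mult mult.commute mult_left_mono)
      show "min ((s * ?r) powr \<delta>) ((s * ?r) powr (- \<delta>)) \<le> (2 * ?n) powr \<delta> * m"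
        using 1 2 unfolding m_def by (simp add: min_mult_distrib_left) linarith
    qed (use A r in auto)
    finally show ?thesis by (simp add: A'_def mult.assoc)
  qed
  have zero: "?D k x = 0" if "k \<le> N" "norm x \<le> 1 / 2 \<or> 2 * ?n \<le> norm x" for k x
    using that(2)
  proof
    assume "norm x \<le> 1 / 2"
    then show ?thesis using that(1) by (intro leibniz_eq_0 Qin) auto
  next
    assume "2 * ?n \<le> norm x"
    then show ?thesis using that(1) by (intro leibniz_eq_0 Qout) auto
  qed
  have "norm (?D k x) \<le> 2 ^ N * (A' * B)" if k: "k \<le> N" for k x
  proof (cases "norm x \<le> 1 / 2 \<or> 2 * ?n \<le> norm x")
    case True
    then show ?thesis
      using zero[OF k True] A m B by (simp add: A'_def)
  next
    case False
    then have "norm (?D k x) \<le> 2 ^ k * (A' * B)"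
      using k by (intro norm_leibniz_le P QB) auto
    also have "\<dots> \<le> 2 ^ N * (A' * B)"
      using k A m B by (intro mult_right_mono power_increasing) (auto simp: A'_def)
    finally show ?thesis .
  qed
  moreover have "2 ^ N * (A' * B) = 2 ^ N * (A * 2 ^ N * (2 * ?n) powr \<delta> * B) * m"
    by (simp add: A'_def mult_ac)
  ultimately show ?thesis
    using chain zero Q(2) unfolding m_def
    by (intro exI[of _ ?D]) (auto simp: leibniz_def P_def)
qed

text \<open>The dilation \<open>x \<mapsto> s ^ CARD('n) * g (s *\<^sub>R x)\<close> preserves the \<open>L\<^sup>1\<close> norm of \<open>g\<close> and replaces
  \<open>\<xi>\<close> by \<open>\<xi> /\<^sub>R s\<close> in its transform, so the decay estimate, made at scale \<open>1\<close>, applies at every scale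
  with the same constant.\<close>
lemma
  fixes h :: "real ^ 'n::finite \<Rightarrow> complex"
  assumes N: "N > CARD('n)" and A: "A \<ge> 0" and s: "s > 0"
    and smooth: "\<And>i. \<exists>D. partial_derivative_chain i N UNIV D \<and> D 0 = h \<and>
        (\<forall>k\<le>N. \<forall>x. (r < norm x \<longrightarrow> D k x = 0) \<and> norm (D k x) \<le> A)"
  defines "G \<equiv> (\<lambda>x. of_real (s ^ CARD('n)) * inverse_fourier h (s *\<^sub>R x))"
  shows integrable_dilated_inverse_fourier: "integrable lborel G"
    and norm_dilated_inverse_fourier_le: "(\<integral>x. norm (G x) \<partial>lborel) \<le>
      2 ^ N * measure lborel (cball (0 :: real ^ 'n) r) * A *
        (\<integral>x. decay_weight (real N / CARD('n)) (x :: real ^ 'n) \<partial>lborel)"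
    and fourier_dilated_inverse_fourier:
      "(\<integral>x. G x * cis (- 2 * pi * (x \<bullet> \<xi>)) \<partial>lborel) = h (\<xi> /\<^sub>R s)"
proof -
  let ?w = "decay_weight (real N / CARD('n)) :: real ^ 'n \<Rightarrow> real"
  let ?K = "2 ^ N * measure lborel (cball (0 :: real ^ 'n) r) * A"
  obtain D where D: "partial_derivative_chain undefined N UNIV D" "D 0 = h"
      "\<forall>k\<le>N. \<forall>x. (r < norm x \<longrightarrow> D k x = 0) \<and> norm (D k x) \<le> A"
    using smooth by blast
  have h: "continuous_on UNIV h" "\<And>x. r < norm x \<Longrightarrow> h x = 0" "\<And>x. norm (h x) \<le> A"
    using D by (auto simp: partial_derivative_chain_def)
  have [measurable]: "h \<in> borel_measurable borel"
    using h(1) by (rule borel_measurable_continuous_onI)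
  have ih: "integrable lborel h"
    by (rule integrable_compact_support[OF h(1,2)])
  have iw: "integrable lborel ?w"
    using N by (intro integrable_decay_weight) simp
  have decay: "norm (inverse_fourier h x) \<le> ?K * ?w x" for x
    by (rule inverse_fourier_decay[OF A smooth])
  have [measurable]: "inverse_fourier h \<in> borel_measurable borel"
    unfolding inverse_fourier_def[abs_def] by measurable
  have iH: "integrable lborel (inverse_fourier h)"
  proof (rule Bochner_Integration.integrable_bound)
    show "integrable lborel (\<lambda>x. ?K * ?w x)"
      using iw by simp
    show "AE x in lborel. norm (inverse_fourier h x) \<le> norm (?K * ?w x)"
      using decay order_trans[OF decay abs_ge_self] by (intro AE_I2) auto
  qed simp
  have s0: "s \<noteq> 0" using s by simp
  show iG: "integrable lborel G"
    unfolding G_def using integrable_lborel_affine[OF s0 iH, of 0] by simp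
  have "(\<integral>x. norm (G x) \<partial>lborel) = s ^ CARD('n) * (\<integral>x. norm (inverse_fourier h (s *\<^sub>R x)) \<partial>lborel)"
    using s by (simp add: G_def norm_mult norm_power)
  also have "\<dots> = (\<integral>x. norm (inverse_fourier h x) \<partial>lborel)"
    using integral_lborel_affine[OF s0 integrable_norm[OF iH], of 0] s by simp
  also have "\<dots> \<le> (\<integral>x. ?K * ?w x \<partial>lborel)"
    using decay iH iw by (intro integral_mono) auto
  finally show "(\<integral>x. norm (G x) \<partial>lborel) \<le> ?K * (\<integral>x. ?w x \<partial>lborel)"
    by simp
  define F where "F y = inverse_fourier h y * cis (- 2 * pi * (y \<bullet> (\<xi> /\<^sub>R s)))" for y
  have iF: "integrable lborel F"
    unfolding F_def by (intro integrable_mult_cis iH) simp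
  have "(\<integral>x. G x * cis (- 2 * pi * (x \<bullet> \<xi>)) \<partial>lborel) =
      (\<integral>x. of_real (s ^ CARD('n)) * F (s *\<^sub>R x) \<partial>lborel)"
  proof (rule Bochner_Integration.integral_cong[OF refl])
    fix x
    have "(s *\<^sub>R x) \<bullet> (\<xi> /\<^sub>R s) = x \<bullet> \<xi>"
      using s by (simp add: field_simps)
    then show "G x * cis (- 2 * pi * (x \<bullet> \<xi>)) = of_real (s ^ CARD('n)) * F (s *\<^sub>R x)"
      unfolding G_def F_def by (simp only: mult.assoc)
  qed
  also have "\<dots> = s ^ CARD('n) *\<^sub>R (\<integral>x. F (s *\<^sub>R x) \<partial>lborel)"
    by (simp add: scaleR_conv_of_real)
  also have "\<dots> = (\<integral>y. F y \<partial>lborel)"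
    using integral_lborel_affine[OF s0 iF, of 0] s by simp
  also have "\<dots> = h (\<xi> /\<^sub>R s)"
    unfolding F_def by (rule fourier_inversion[OF h(1,3) ih iH])
  finally show "(\<integral>x. G x * cis (- 2 * pi * (x \<bullet> \<xi>)) \<partial>lborel) = h (\<xi> /\<^sub>R s)" .
qed

section \<open>Summing the pieces\<close>

lemma AE_summable_norm:
  fixes G :: "nat \<Rightarrow> 'a \<Rightarrow> 'b::{banach,second_countable_topology}"
  assumes G: "\<And>k. integrable M (G k)" and sum: "summable (\<lambda>k. \<integral>x. norm (G k x) \<partial>M)"
  shows "AE x in M. summable (\<lambda>k. norm (G k x))"
proof -
  have [measurable]: "G k \<in> borel_measurable M" for k using G by auto
  have "(\<integral>\<^sup>+x. (\<Sum>k. ennreal (norm (G k x))) \<partial>M) = (\<Sum>k. \<integral>\<^sup>+x. ennreal (norm (G k x)) \<partial>M)"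
    by (rule nn_integral_suminf) auto
  also have "\<dots> = (\<Sum>k. ennreal (\<integral>x. norm (G k x) \<partial>M))"
    by (intro suminf_cong nn_integral_eq_integral) (auto intro: G)
  also have "\<dots> \<noteq> \<infinity>"
    using sum by (simp add: ennreal_suminf_neq_top)
  finally have "AE x in M. (\<Sum>k. ennreal (norm (G k x))) \<noteq> \<infinity>"
    by (intro nn_integral_PInf_AE) auto
  then show ?thesis
    by eventually_elim (auto intro: summable_suminf_not_top)
qed

lemma fourier_lborel:
  assumes "g \<in> borel_measurable borel"
  shows "fourier g \<xi> = (\<integral>x. g x * cis (- 2 * pi * (x \<bullet> \<xi>)) \<partial>lborel)"
proof -
  have "exp (- 2 * of_real pi * \<i> * of_real t) = cis (- 2 * pi * t)" for t
    by (simp add: cis_conv_exp mult_ac)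
  then show ?thesis
    unfolding fourier_def using assms by (simp add: integral_completion)
qed

text \<open>Absolute convergence in \<open>L\<^sup>1\<close> allows the Fourier transform to be taken term by term.\<close>
lemma fourier_suminf:
  fixes G :: "nat \<Rightarrow> real ^ 'n::finite \<Rightarrow> complex"
  assumes G: "\<And>k. integrable lborel (G k)" and sum: "summable (\<lambda>k. \<integral>x. norm (G k x) \<partial>lborel)"
    and f: "\<And>\<xi>. \<xi> \<noteq> 0 \<Longrightarrow> (\<lambda>k. \<integral>x. G k x * cis (- 2 * pi * (x \<bullet> \<xi>)) \<partial>lborel) sums f \<xi>"
  shows "\<exists>g. integrable lebesgue g \<and> (AE \<xi> in lebesgue. fourier g \<xi> = f \<xi>)"
proof -
  define g where "g x = (\<Sum>k. G k x)" for x
  have [measurable]: "G k \<in> borel_measurable borel" for k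
    using borel_measurable_integrable[OF G] by simp
  have AE: "AE x in lborel. summable (\<lambda>k. norm (G k x))"
    by (rule AE_summable_norm[OF G sum])
  have ig: "integrable lborel g"
    unfolding g_def by (rule integrable_suminf[OF G AE sum])
  have [measurable]: "g \<in> borel_measurable borel"
    using borel_measurable_integrable[OF ig] by simp
  have "fourier g \<xi> = f \<xi>" if "\<xi> \<noteq> 0" for \<xi>
  proof -
    let ?c = "\<lambda>x. cis (- 2 * pi * (x \<bullet> \<xi>))"
    have "(\<lambda>k. \<integral>x. G k x * ?c x \<partial>lborel) sums (\<integral>x. (\<Sum>k. G k x * ?c x) \<partial>lborel)"
    proof (rule sums_integral)
      show "integrable lborel (\<lambda>x. G k x * ?c x)" for k
        by (intro integrable_mult_cis G) simp
    qed (use AE sum in \<open>simp_all add: norm_mult\<close>)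
    then have "f \<xi> = (\<integral>x. (\<Sum>k. G k x * ?c x) \<partial>lborel)"
      using f[OF that] by (rule sums_unique2[rotated])
    also have "\<dots> = (\<integral>x. g x * ?c x \<partial>lborel)"
    proof (rule integral_cong_AE)
      show "AE x in lborel. (\<Sum>k. G k x * ?c x) = g x * ?c x"
        using AE by eventually_elim (simp add: g_def suminf_mult2[OF summable_norm_cancel])
    qed measurable
    finally show ?thesis
      by (simp add: fourier_lborel)
  qed
  moreover have "AE \<xi> in lebesgue. \<xi> \<noteq> (0 :: real ^ 'n)"
    by (intro AE_completion AE_lborel_singleton)
  ultimately have "AE \<xi> in lebesgue. fourier g \<xi> = f \<xi>"
    by (auto elim: eventually_mono)
  moreover have "integrable lebesgue g"
    using ig by (simp add: integrable_completion)
  ultimately show ?thesis by blast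
qed

text \<open>Both series telescope: the scales \<open>2 ^ k\<close> run up to \<open>X 0 = 1\<close>, the scales \<open>1 / 2 ^ Suc k\<close> run out
  to where \<open>X\<close> vanishes, and they meet at \<open>X (2 *\<^sub>R x)\<close>, which cancels.\<close>
lemma dyadic_resolution:
  fixes X :: "'a::real_normed_vector \<Rightarrow> complex"
  assumes X1: "\<And>x. norm x \<le> 1 \<Longrightarrow> X x = 1" and X0: "\<And>x. R \<le> norm x \<Longrightarrow> X x = 0"
    and "x \<noteq> 0"
  defines "\<phi> \<equiv> (\<lambda>x. X x - X (2 *\<^sub>R x))"
  shows "(\<lambda>k. \<phi> (x /\<^sub>R 2 ^ k) + \<phi> (x /\<^sub>R (1 / 2 ^ Suc k))) sums 1"
proof -
  define a where "a k = X (2 *\<^sub>R (x /\<^sub>R 2 ^ k))" for k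
  define b where "b k = X (x /\<^sub>R (1 / 2 ^ Suc k))" for k
  have "\<forall>\<^sub>F k in sequentially. norm (2 *\<^sub>R (x /\<^sub>R 2 ^ k)) \<le> 1"
  proof -
    have "(\<lambda>k. 2 * norm x * (1 / 2) ^ k) \<longlonglongrightarrow> 2 * norm x * 0"
      by (intro tendsto_intros LIMSEQ_power_zero) simp
    then have "\<forall>\<^sub>F k in sequentially. 2 * norm x * (1 / 2) ^ k < 1"
      by (rule order_tendstoD(2)) simp
    then show ?thesis
      by (rule eventually_mono) (simp add: power_one_over field_simps)
  qed
  then have "\<forall>\<^sub>F k in sequentially. 1 = a k"
    by (rule eventually_mono) (simp add: a_def X1)
  then have a: "a \<longlonglongrightarrow> 1"
    by (rule Lim_transform_eventually[OF tendsto_const])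
  have "\<forall>\<^sub>F k in sequentially. R \<le> norm (x /\<^sub>R (1 / 2 ^ Suc k))"
  proof -
    obtain m where m: "R / (2 * norm x) < 2 ^ m"
      using real_arch_pow[of 2 "R / (2 * norm x)"] by auto
    then have "R / (2 * norm x) \<le> 2 ^ k" if "m \<le> k" for k
      using order_trans[OF less_imp_le[OF m] power_increasing[OF that]] by simp
    then have "\<forall>\<^sub>F k in sequentially. R / (2 * norm x) \<le> 2 ^ k"
      unfolding eventually_sequentially by blast
    then show ?thesis
      by (rule eventually_mono) (use \<open>x \<noteq> 0\<close> in \<open>simp add: field_simps\<close>)
  qed
  then have "\<forall>\<^sub>F k in sequentially. 0 = b k"
    by (rule eventually_mono) (simp add: b_def X0)
  then have b: "b \<longlonglongrightarrow> 0"
    by (rule Lim_transform_eventually[OF tendsto_const])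
  have "(\<lambda>k. (a (Suc k) - a k) + (b k - b (Suc k))) sums ((1 - a 0) + (b 0 - 0))"
    by (intro sums_add telescope_sums telescope_sums' a b)
  moreover have "\<phi> (x /\<^sub>R 2 ^ k) = a (Suc k) - a k" for k
    by (simp add: \<phi>_def a_def)
  moreover have "\<phi> (x /\<^sub>R (1 / 2 ^ Suc k)) = b k - b (Suc k)" for k
    by (simp add: \<phi>_def b_def)
  moreover have "a 0 = b 0"
    by (simp add: a_def b_def)
  ultimately show ?thesis
    by simp
qed

theorem proposition1p6:
  fixes f :: "real ^ 'n::finite \<Rightarrow> complex" and N :: nat and C \<delta>1 \<delta>2 :: real
  assumes "N > CARD('n)"
    and "L_infinity f"
    and "Ck_on N (UNIV - {0}) f"
    and "C > 0" and "\<delta>1 > 0" and "\<delta>2 > 0"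
    and "\<And>\<alpha> \<xi>. order_of \<alpha> \<le> N \<Longrightarrow> norm \<xi> \<ge> 1 \<Longrightarrow>
           norm (partials \<alpha> f \<xi>) \<le> C * norm \<xi> powr (- \<delta>1 - real (order_of \<alpha>))"
    and "\<And>\<alpha> \<xi>. order_of \<alpha> \<le> N \<Longrightarrow> 0 < norm \<xi> \<Longrightarrow> norm \<xi> \<le> 2 \<Longrightarrow>
           norm (partials \<alpha> f \<xi>)
             \<le> C * norm \<xi> powr (\<delta>2 - real (order_of \<alpha>)) * (1 + \<bar>ln (norm \<xi>)\<bar>)"
  shows "\<exists>g :: real ^ 'n \<Rightarrow> complex.
           integrable lebesgue g \<and> (AE \<xi> in lebesgue. fourier g \<xi> = f \<xi>)"
proof -
  obtain A \<delta> where A: "A \<ge> 0" "\<delta> > 0" and bound: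
    "\<And>i k \<xi>. k \<le> N \<Longrightarrow> \<xi> \<noteq> 0 \<Longrightarrow> norm ((partial i ^^ k) f \<xi>)
        \<le> A * norm \<xi> powr (- real k) * min (norm \<xi> powr \<delta>) (norm \<xi> powr (- \<delta>))"
    using pure_derivative_bound[OF assms(4-8)] by blast
  obtain X :: "real ^ 'n \<Rightarrow> complex" and Q :: "'n \<Rightarrow> nat \<Rightarrow> real ^ 'n \<Rightarrow> complex" and B :: real
    where X: "\<And>x. norm x \<le> 1 \<Longrightarrow> X x = 1" "\<And>x. 2 * real CARD('n) \<le> norm x \<Longrightarrow> X x = 0"
    and Q: "\<And>i. partial_derivative_chain i N UNIV (Q i)" "\<And>i x. Q i 0 x = X x - X (2 *\<^sub>R x)"
    "\<And>i k x. k \<le> N \<Longrightarrow> norm (Q i k x) \<le> B"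
    "\<And>i k x. k \<le> N \<Longrightarrow> norm x \<le> 1 / 2 \<Longrightarrow> Q i k x = 0"
    "\<And>i k x. k \<le> N \<Longrightarrow> 2 * real CARD('n) \<le> norm x \<Longrightarrow> Q i k x = 0"
    using annulus_cutoff_exists[of N] by blast
  define \<phi> where "\<phi> x = X x - X (2 *\<^sub>R x)" for x
  define h where "h s x = f (s *\<^sub>R x) * \<phi> x" for s x
  define m where "m s = min (s powr \<delta>) (s powr (- \<delta>))" for s :: real
  define K where "K = 2 ^ N * (A * 2 ^ N * (2 * real CARD('n)) powr \<delta> * B)"
  (* h s is the piece f * phi(. / s) rescaled to unit size; G s has that piece as its transform *)
  define G where "G s x = of_real (s ^ CARD('n)) * inverse_fourier (h s) (s *\<^sub>R x)" for s x
  define L where "L = 2 ^ N * measure lborel (cball (0 :: real ^ 'n) (2 * real CARD('n))) * K *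
      (\<integral>x. decay_weight (real N / CARD('n)) (x :: real ^ 'n) \<partial>lborel)"
  have "B \<ge> 0" using Q(3)[of 0 undefined 0] norm_ge_zero order_trans by blast
  then have K: "K \<ge> 0" using A by (simp add: K_def)
  have L: "L \<ge> 0"
    using K by (auto simp: L_def decay_weight_nonneg intro!: mult_nonneg_nonneg integral_nonneg)
  have m0: "m s \<ge> 0" for s
    by (simp add: m_def)
  have Q0: "Q i 0 = \<phi>" for i
    by (simp add: \<phi>_def Q(2) fun_eq_iff)
  have pieces: "\<exists>D. partial_derivative_chain i N UNIV D \<and> D 0 = h s \<and>
      (\<forall>k\<le>N. \<forall>x. (2 * real CARD('n) < norm x \<longrightarrow> D k x = 0) \<and> norm (D k x) \<le> K * m s)"
    if "s > 0" for s i
    unfolding h_def[abs_def] K_def m_def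
    by (rule localised_pieces[OF assms(3) A bound Q(1) Q0 Q(3-5) that])
  have iG: "integrable lborel (G s)" if "s > 0" for s
    unfolding G_def[abs_def]
    by (rule integrable_dilated_inverse_fourier[OF assms(1) _ that pieces[OF that]]) (simp add: K m0)
  have nG: "(\<integral>x. norm (G s x) \<partial>lborel) \<le> L * m s" if "s > 0" for s
    using norm_dilated_inverse_fourier_le[OF assms(1) _ that pieces[OF that]] K m0
    unfolding G_def[abs_def] L_def by (simp add: mult_ac)
  have fG: "(\<integral>x. G s x * cis (- 2 * pi * (x \<bullet> \<xi>)) \<partial>lborel) = f \<xi> * \<phi> (\<xi> /\<^sub>R s)" if "s > 0" for s \<xi>
    unfolding G_def fourier_dilated_inverse_fourier[OF assms(1) mult_nonneg_nonneg[OF K m0] that pieces[OF that]]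
    using that by (simp add: h_def)
  (* one large and one small scale at a time, so that a single series over the naturals suffices *)
  define F where "F k x = G (2 ^ k) x + G (1 / 2 ^ Suc k) x" for k x
  have iF: "integrable lborel (F k)" for k
    unfolding F_def[abs_def] by (intro Bochner_Integration.integrable_add iG) auto
  have "summable (\<lambda>k. \<integral>x. norm (F k x) \<partial>lborel)"
  proof (rule summable_comparison_test')
    have "2 powr (- \<delta>) < (1 :: real)"
      using A powr_less_mono[of "- \<delta>" 0 2] by simp
    then show "summable (\<lambda>k. 2 * L * (2 powr (- \<delta>)) ^ k)"
      by (intro summable_mult summable_geometric) simp
    fix k :: nat assume "0 \<le> k"
    have p: "(2 ^ j) powr a = (2 powr a) ^ j" for j and a :: real
      by (simp add: powr_realpow[symmetric] powr_powr mult.commute)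
    have "m (2 ^ k) \<le> (2 powr (- \<delta>)) ^ k"
      unfolding m_def p by simp
    moreover have "m (1 / 2 ^ Suc k) \<le> (2 powr (- \<delta>)) ^ k"
    proof -
      have "m (1 / 2 ^ Suc k) \<le> (1 / 2 ^ Suc k) powr \<delta>"
        unfolding m_def by simp
      also have "\<dots> = (2 ^ Suc k) powr (- \<delta>)"
        by (simp add: powr_divide powr_minus_divide del: power_Suc)
      also have "\<dots> = (2 powr (- \<delta>)) ^ Suc k"
        by (rule p)
      also have "\<dots> \<le> (2 powr (- \<delta>)) ^ k"
        using \<open>2 powr (- \<delta>) < 1\<close> by (intro power_decreasing) auto
      finally show ?thesis .
    qed
    ultimately have "L * m (2 ^ k) + L * m (1 / 2 ^ Suc k) \<le> L * (2 powr (- \<delta>)) ^ k + L * (2 powr (- \<delta>)) ^ k"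
      using L by (intro add_mono mult_left_mono)
    moreover have "(\<integral>x. norm (F k x) \<partial>lborel) \<le> (\<integral>x. norm (G (2 ^ k) x) + norm (G (1 / 2 ^ Suc k) x) \<partial>lborel)"
      unfolding F_def
      by (intro integral_mono norm_triangle_ineq integrable_norm Bochner_Integration.integrable_add iG) auto
    moreover have "(\<integral>x. norm (G (2 ^ k) x) + norm (G (1 / 2 ^ Suc k) x) \<partial>lborel) \<le> L * m (2 ^ k) + L * m (1 / 2 ^ Suc k)"
      by (subst Bochner_Integration.integral_add) (auto intro!: integrable_norm iG add_mono nG simp del: power_Suc)
    ultimately show "norm (\<integral>x. norm (F k x) \<partial>lborel) \<le> 2 * L * (2 powr (- \<delta>)) ^ k"
      by simp
  qed
  moreover have "(\<lambda>k. \<integral>x. F k x * cis (- 2 * pi * (x \<bullet> \<xi>)) \<partial>lborel) sums f \<xi>" if "\<xi> \<noteq> 0" for \<xi>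
  proof -
    have "(\<lambda>k. f \<xi> * (\<phi> (\<xi> /\<^sub>R 2 ^ k) + \<phi> (\<xi> /\<^sub>R (1 / 2 ^ Suc k)))) sums (f \<xi> * 1)"
      unfolding \<phi>_def by (intro sums_mult dyadic_resolution X that)
    moreover have "(\<integral>x. F k x * cis (- 2 * pi * (x \<bullet> \<xi>)) \<partial>lborel) =
        f \<xi> * (\<phi> (\<xi> /\<^sub>R 2 ^ k) + \<phi> (\<xi> /\<^sub>R (1 / 2 ^ Suc k)))" for k
    proof -
      have "(\<integral>x. F k x * cis (- 2 * pi * (x \<bullet> \<xi>)) \<partial>lborel) =
          (\<integral>x. G (2 ^ k) x * cis (- 2 * pi * (x \<bullet> \<xi>)) \<partial>lborel) +
          (\<integral>x. G (1 / 2 ^ Suc k) x * cis (- 2 * pi * (x \<bullet> \<xi>)) \<partial>lborel)"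
        unfolding F_def distrib_right
        by (intro Bochner_Integration.integral_add integrable_mult_cis iG) auto
      also have "\<dots> = f \<xi> * \<phi> (\<xi> /\<^sub>R 2 ^ k) + f \<xi> * \<phi> (\<xi> /\<^sub>R (1 / 2 ^ Suc k))"
        by (intro arg_cong2[where f="(+)"] fG) auto
      finally show ?thesis by (simp only: distrib_left)
    qed
    ultimately show ?thesis by simp
  qed
  ultimately show ?thesis
    by (intro fourier_suminf[OF iF])
qed

end
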